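(* Let $1\leq p<\infty$, let $X=\ell^p(\mathbb{N}_0)$ or $X=\ell^p(\mathbb{Z})$, and let $B_w$ be a weighted backward shift that is a bounded operator on $X$, i.e. $B_w(x_n)_{n}=(w_{n+1}x_{n+1})_{n}$ for a sequence $w$ of non-zero scalars (indexed by $n\geq 1$ in the case of $\mathbb{N}_0$ and by $n\in\mathbb{Z}$ in the case of $\mathbb{Z}$). Suppose there exist $x\in X$ and a non-zero vector $y\in X$ such that, for every neighbourhood $V$ of $y$, the set \[ \{ n\geq 0 : B_w^n x \in V\} \] has positive upper Banach density. Then $B_w$ is chaotic and therefore frequently hypercyclic.
   Context: The upper Banach density of $A\subset\mathbb{N}_0$ is $\lim_{N\to\infty}\sup_{m\geq 0}\frac{|A\cap[m,m+N]|}{N+1}$. An operator $T$ is hypercyclic if some orbit $\{T^nx:n\ge0\}$ is dense; it is chaotic if it is hypercyclic and its set of periodic points is dense; it is frequently hypercyclic if there is $x$ such that for every non-empty open set $U$ the set $\{n\geq 0: T^nx\in U\}$ has positive lower density. *)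

theory Defs
  imports "HOL-Analysis.Analysis"
begin

text \<open>Sequence spaces: sequences are functions int => 'a, where 'a is the scalar field
 (any complete real normed field, i.e. R or C). The index set I is either {0..} (for N_0)
 or UNIV (for Z); sequences vanish outside I.\<close>

definition lp_space :: "int set \<Rightarrow> real \<Rightarrow> (int \<Rightarrow> 'a::real_normed_field) set" where
  "lp_space I p = {x. (\<forall>n. n \<notin> I \<longrightarrow> x n = 0) \<and> (\<lambda>n. norm (x n) powr p) summable_on UNIV}"

definition lp_norm :: "real \<Rightarrow> (int \<Rightarrow> 'a::real_normed_field) \<Rightarrow> real" where
  "lp_norm p x = (infsum (\<lambda>n. norm (x n) powr p) UNIV) powr (1 / p)"

definition lp_dist :: "real \<Rightarrow> (int \<Rightarrow> 'a::real_normed_field) \<Rightarrow> (int \<Rightarrow> 'a) \<Rightarrow> real" where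
  "lp_dist p x y = lp_norm p (x - y)"

definition bw_shift :: "int set \<Rightarrow> (int \<Rightarrow> 'a::real_normed_field) \<Rightarrow> (int \<Rightarrow> 'a) \<Rightarrow> (int \<Rightarrow> 'a)" where
  "bw_shift I w x = (\<lambda>n. if n \<in> I then w (n + 1) * x (n + 1) else 0)"

definition open_ball_in :: "'x set \<Rightarrow> ('x \<Rightarrow> 'x \<Rightarrow> real) \<Rightarrow> 'x \<Rightarrow> real \<Rightarrow> 'x set" where
  "open_ball_in X d y e = {z \<in> X. d z y < e}"

definition nbhd_in :: "'x set \<Rightarrow> ('x \<Rightarrow> 'x \<Rightarrow> real) \<Rightarrow> 'x \<Rightarrow> 'x set \<Rightarrow> bool" where
  "nbhd_in X d y V \<longleftrightarrow> (\<exists>e>0. open_ball_in X d y e \<subseteq> V)"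

definition open_in_sp :: "'x set \<Rightarrow> ('x \<Rightarrow> 'x \<Rightarrow> real) \<Rightarrow> 'x set \<Rightarrow> bool" where
  "open_in_sp X d U \<longleftrightarrow> U \<subseteq> X \<and> (\<forall>u\<in>U. nbhd_in X d u U)"

definition dense_in_sp :: "'x set \<Rightarrow> ('x \<Rightarrow> 'x \<Rightarrow> real) \<Rightarrow> 'x set \<Rightarrow> bool" where
  "dense_in_sp X d A \<longleftrightarrow> (\<forall>z\<in>X. \<forall>e>0. \<exists>a\<in>A. d a z < e)"

definition hypercyclic :: "'x set \<Rightarrow> ('x \<Rightarrow> 'x \<Rightarrow> real) \<Rightarrow> ('x \<Rightarrow> 'x) \<Rightarrow> bool" where
  "hypercyclic X d T \<longleftrightarrow> (\<exists>x\<in>X. dense_in_sp X d {(T ^^ n) x | n. True})"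

definition periodic_points :: "'x set \<Rightarrow> ('x \<Rightarrow> 'x) \<Rightarrow> 'x set" where
  "periodic_points X T = {x \<in> X. \<exists>n>0. (T ^^ n) x = x}"

definition chaotic :: "'x set \<Rightarrow> ('x \<Rightarrow> 'x \<Rightarrow> real) \<Rightarrow> ('x \<Rightarrow> 'x) \<Rightarrow> bool" where
  "chaotic X d T \<longleftrightarrow> hypercyclic X d T \<and> dense_in_sp X d (periodic_points X T)"

definition lower_density :: "nat set \<Rightarrow> ereal" where
  "lower_density A = liminf (\<lambda>N. ereal (real (card (A \<inter> {..N})) / real (N + 1)))"

definition upper_banach_density :: "nat set \<Rightarrow> real" where
  "upper_banach_density A =
     lim (\<lambda>N. SUP m. real (card (A \<inter> {m..m + N})) / real (N + 1))"

definition frequently_hypercyclic :: "'x set \<Rightarrow> ('x \<Rightarrow> 'x \<Rightarrow> real) \<Rightarrow> ('x \<Rightarrow> 'x) \<Rightarrow> bool" where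
  "frequently_hypercyclic X d T \<longleftrightarrow>
     (\<exists>x\<in>X. \<forall>U. open_in_sp X d U \<and> U \<noteq> {} \<longrightarrow> lower_density {n. (T ^^ n) x \<in> U} > 0)"

end

theory Submission
  imports Defs "HOL-Computational_Algebra.Fundamental_Theorem_Algebra"
begin

text \<open>
  Let e be the formal fixed vector of the shift T, i.e. e n = w (n+1) e (n+1) on I and e = 0 off I.
  Writing x = e \<xi>, the orbit is T^n x = e \<xi>(\<cdot> + n), so everything happens in a weighted space with
  weights a i = |e i|^p under the plain shift. It suffices to show that e lies in the space.

  Let k satisfy y k \<noteq> 0 and let A be the set of n for which T^n x is close to y. For n in A,
  |\<xi>(k + n)| is bounded below, and hence the norm of T^n x bounds the sum of a(k + m - n) over m in A,
  uniformly in n in A. Averaging over n in a long window in which A is dense, the weight a(k + j) is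
  counted as often as j is a difference of elements of A in this window. Differences that occur a
  positive proportion of times form a syndetic set, and a i \<le> L a (i+1) since T is bounded, so a is
  summable.

  Once e is in the space, e times a periodic bounded sequence is a periodic point, and a frequently
  hypercyclic vector is e times a concatenation of blocks from a countable dense family, where blocks
  of high level (long or large) are rare and far from the others. Countability needs the scalar
  field to be separable; an elementary form of the Gelfand-Mazur theorem shows that it is
  spanned by two elements over the reals.
\<close>

section \<open>Separability of real normed fields\<close>

lemma poly_map_of_real_add:
  "poly (map_poly of_real (P + Q)) b = poly (map_poly of_real P) b + poly (map_poly of_real Q) b"
  for b :: "'a::real_normed_field"
  by (induction P Q rule: poly_induct2) (simp_all add: map_poly_pCons algebra_simps)

lemma poly_map_of_real_smult:
  "poly (map_poly of_real (smult c P)) b = of_real c * poly (map_poly of_real P) b"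
  for b :: "'a::real_normed_field"
  by (induction P) (simp_all add: map_poly_pCons algebra_simps)

lemma poly_map_of_real_mult:
  "poly (map_poly of_real (P * Q)) b = poly (map_poly of_real P) b * poly (map_poly of_real Q) b"
  for b :: "'a::real_normed_field"
  by (induction P)
    (simp_all add: map_poly_pCons poly_map_of_real_add poly_map_of_real_smult algebra_simps)

lemma poly_map_of_real_power:
  "poly (map_poly of_real (P ^ n)) b = poly (map_poly of_real P) b ^ n"
  for b :: "'a::real_normed_field"
  by (induction n) (simp_all add: poly_map_of_real_mult map_poly_1)

text \<open>The field need not contain a square root of -1, so the value of \<open>Q\<close> at
  \<open>a\<close> is kept as a pair, an element of the complexification of the field. The pair is
  formed by \<open>re_eval\<close> and \<open>im_eval\<close>, and \<open>eval_mult\<close> is the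
  product in the complexification.\<close>

definition re_eval :: "'a::real_normed_field \<Rightarrow> complex poly \<Rightarrow> 'a" where
  "re_eval a Q = poly (map_poly (\<lambda>c. of_real (Re c)) Q) a"

definition im_eval :: "'a::real_normed_field \<Rightarrow> complex poly \<Rightarrow> 'a" where
  "im_eval a Q = poly (map_poly (\<lambda>c. of_real (Im c)) Q) a"

text \<open>The number below is the norm of R a, where R is the real polynomial Q times its conjugate.\<close>

definition eval_norm :: "'a::real_normed_field \<Rightarrow> complex poly \<Rightarrow> real" where
  "eval_norm a Q = norm ((re_eval a Q)\<^sup>2 + (im_eval a Q)\<^sup>2)"

lemma eval_0 [simp]: "re_eval a 0 = 0" "im_eval a 0 = 0"
  by (simp_all add: re_eval_def im_eval_def)

lemma eval_pCons [simp]: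
  "re_eval a (pCons c Q) = of_real (Re c) + a * re_eval a Q"
  "im_eval a (pCons c Q) = of_real (Im c) + a * im_eval a Q"
  by (simp_all add: re_eval_def im_eval_def map_poly_pCons)

lemma eval_add:
  "re_eval a (P + Q) = re_eval a P + re_eval a Q"
  "im_eval a (P + Q) = im_eval a P + im_eval a Q"
  by (induction P Q rule: poly_induct2) (simp_all add: algebra_simps)

lemma eval_smult:
  "re_eval a (smult c Q) = of_real (Re c) * re_eval a Q - of_real (Im c) * im_eval a Q"
  "im_eval a (smult c Q) = of_real (Re c) * im_eval a Q + of_real (Im c) * re_eval a Q"
proof (induction Q)
  case (pCons d Q)
  {
    case 1
    show ?case unfolding smult_pCons eval_pCons pCons by (simp add: algebra_simps)
  next
    case 2
    show ?case unfolding smult_pCons eval_pCons pCons by (simp add: algebra_simps)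
  }
qed simp_all

lemma eval_mult:
  "re_eval a (P * Q) = re_eval a P * re_eval a Q - im_eval a P * im_eval a Q"
  "im_eval a (P * Q) = re_eval a P * im_eval a Q + im_eval a P * re_eval a Q"
proof (induction P)
  case (pCons c P)
  {
    case 1
    show ?case unfolding mult_pCons_left eval_pCons eval_add eval_smult pCons
      by (simp add: algebra_simps)
  next
    case 2
    show ?case unfolding mult_pCons_left eval_pCons eval_add eval_smult pCons
      by (simp add: algebra_simps)
  }
qed simp_all

text \<open>The two-squares identity of Brahmagupta, combined with multiplicativity of the
  norm.\<close>

lemma eval_norm_mult: "eval_norm a (P * Q) = eval_norm a P * eval_norm a Q"
proof -
  have "(re_eval a (P * Q))\<^sup>2 + (im_eval a (P * Q))\<^sup>2 =
      ((re_eval a P)\<^sup>2 + (im_eval a P)\<^sup>2) * ((re_eval a Q)\<^sup>2 + (im_eval a Q)\<^sup>2)"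
    by (simp add: eval_mult power2_eq_square algebra_simps)
  then show ?thesis
    by (simp add: eval_norm_def norm_mult)
qed

lemma eval_norm_const: "eval_norm a [:c:] = (cmod c)\<^sup>2"
proof -
  have "eval_norm a [:c:] = norm (of_real ((Re c)\<^sup>2 + (Im c)\<^sup>2) :: 'a)"
    by (simp add: eval_norm_def)
  then show ?thesis
    by (simp only: norm_of_real cmod_power2) simp
qed

text \<open>Over the complex numbers \<open>Q\<close> splits into linear factors, and
  \<open>eval_norm\<close> is multiplicative; the induction on the degree removes one root at a
  time.\<close>

lemma eval_norm_lower_bound:
  assumes "\<And>z. m \<le> eval_norm a [:- z, 1:]" "0 \<le> m"
  shows "(cmod (lead_coeff Q))\<^sup>2 * m ^ degree Q \<le> eval_norm a Q"
proof (induction "degree Q" arbitrary: Q)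
  case 0
  then obtain c where "Q = [:c:]" by (metis degree_eq_zeroE)
  then show ?case by (simp add: eval_norm_const)
next
  case (Suc n)
  then have "\<not> constant (poly Q)" by (simp add: constant_degree)
  then obtain z where "poly Q z = 0" using fundamental_theorem_of_algebra by blast
  then obtain R where R: "Q = [:- z, 1:] * R" by (auto simp: poly_eq_0_iff_dvd)
  with Suc.hyps(2) have "R \<noteq> 0" by auto
  then have d: "degree Q = Suc (degree R)" unfolding R by (subst degree_mult_eq) auto
  have l: "lead_coeff Q = lead_coeff R" unfolding R by (simp only: lead_coeff_mult) simp
  have "(cmod (lead_coeff R))\<^sup>2 * m ^ degree R \<le> eval_norm a R"
    using Suc d by auto
  then have "m * ((cmod (lead_coeff R))\<^sup>2 * m ^ degree R) \<le> eval_norm a [:- z, 1:] * eval_norm a R"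
    using assms by (intro mult_mono) (auto intro: order_trans)
  also have "\<dots> = eval_norm a Q" unfolding R eval_norm_mult ..
  finally show ?case unfolding l by (simp add: d mult_ac)
qed

lemma eval_of_real_poly:
  "re_eval a (map_poly complex_of_real P) = poly (map_poly of_real P) a"
  "im_eval a (map_poly complex_of_real P) = 0"
  by (induction P) (simp_all add: map_poly_pCons)

lemma eval_norm_linear:
  "eval_norm a [:- z, 1:] = norm ((a - of_real (Re z))\<^sup>2 + of_real ((Im z)\<^sup>2))"
  by (simp add: eval_norm_def algebra_simps)

text \<open>Outside a disc the value exceeds the one at 0, so compactness gives a minimum. The
  minimisers form a compact set, so one of them has largest modulus; a point farther from 0 then has
  a strictly larger value.\<close>

lemma eval_linear_attains_min:
  fixes a :: "'a::real_normed_field"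
  obtains z0 where "\<And>z. eval_norm a [:- z0, 1:] \<le> eval_norm a [:- z, 1:]"
    "\<And>z. eval_norm a [:- z, 1:] = eval_norm a [:- z0, 1:] \<Longrightarrow> cmod z \<le> cmod z0"
proof -
  define f where "f z = eval_norm a [:- z, 1:]" for z
  define A where "A = norm a"
  have cont: "continuous_on S f" for S
    unfolding f_def eval_norm_linear by (intro continuous_intros)
  have f0: "f 0 = A\<^sup>2" unfolding f_def eval_norm_linear by (simp add: A_def norm_power)
  \<comment> \<open>The triangle inequality gives \<open>f z\<close> at least
    \<open>|z| * (|z| - 2 * A) - A^2\<close>, and beyond the radius \<open>3 * A + 1\<close> the
    product already exceeds \<open>2 * A^2\<close>.\<close>
  have large: "f z > f 0" if z: "cmod z > 3 * A + 1" for z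
  proof -
    have "(a - of_real (Re z))\<^sup>2 + of_real ((Im z)\<^sup>2) =
        a\<^sup>2 - 2 * of_real (Re z) * a + (of_real ((cmod z)\<^sup>2) :: 'a)"
      unfolding cmod_power2 by (simp add: power2_eq_square algebra_simps)
    then have "of_real ((cmod z)\<^sup>2) =
       ((a - of_real (Re z))\<^sup>2 + of_real ((Im z)\<^sup>2)) - a\<^sup>2 + 2 * of_real (Re z) * a"
      by (simp add: algebra_simps)
    then have "norm (of_real ((cmod z)\<^sup>2) :: 'a) \<le> f z + norm (a\<^sup>2) + norm (2 * of_real (Re z) * a)"
      unfolding f_def eval_norm_linear by (metis norm_triangle_le norm_triangle_ineq4 add_right_mono)
    then have "(cmod z)\<^sup>2 \<le> f z + A\<^sup>2 + 2 * \<bar>Re z\<bar> * A"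
      by (simp add: norm_mult norm_power A_def)
    moreover have "\<bar>Re z\<bar> * A \<le> cmod z * A"
      by (intro mult_right_mono abs_Re_le_cmod) (simp add: A_def)
    moreover have "cmod z * (cmod z - 2 * A) \<ge> (3 * A + 1) * (A + 1)"
      using z by (intro mult_mono) (auto simp: A_def intro: order_trans)
    moreover have "A \<ge> 0" by (simp add: A_def)
    moreover have "A * A \<ge> 0" by simp
    moreover have "(3 * A + 1) * (A + 1) = 3 * (A * A) + 4 * A + 1"
      "cmod z * (cmod z - 2 * A) = cmod z * cmod z - 2 * (cmod z * A)"
      by (simp_all add: algebra_simps)
    ultimately show ?thesis unfolding f0 power2_eq_square by linarith
  qed
  define B where "B = cball (0::complex) (3 * A + 1)"
  have "0 \<in> B" by (simp add: B_def A_def add_nonneg_nonneg)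
  then have "B \<noteq> {}" "compact B" by (auto simp: B_def)
  then obtain z1 where z1: "z1 \<in> B" "\<And>z. z \<in> B \<Longrightarrow> f z1 \<le> f z"
    using continuous_attains_inf[OF _ _ cont] by metis
  have min: "f z1 \<le> f z" for z
  proof (cases "z \<in> B")
    case False
    then have "f 0 < f z" by (intro large) (simp add: B_def)
    with z1(2)[OF \<open>0 \<in> B\<close>] show ?thesis by simp
  qed (use z1 in auto)
  define S where "S = {z \<in> B. f z = f z1}"
  have "closed S" unfolding S_def
    by (intro continuous_closed_preimage_constant cont) (simp add: B_def)
  moreover have "S \<subseteq> B" by (auto simp: S_def)
  ultimately have "compact S" using \<open>compact B\<close> by (metis compact_Int_closed inf.absorb_iff2)
  moreover have "S \<noteq> {}" using z1 by (auto simp: S_def)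
  ultimately obtain z0 where z0: "z0 \<in> S" "\<And>z. z \<in> S \<Longrightarrow> cmod z \<le> cmod z0"
    using continuous_attains_sup[of S cmod] continuous_on_norm_id by metis
  have f_z0: "f z0 = f z1" using z0 by (simp add: S_def)
  show ?thesis
  proof (rule that)
    show "eval_norm a [:- z0, 1:] \<le> eval_norm a [:- z, 1:]" for z
      using min f_z0 by (simp add: f_def)
    show "cmod z \<le> cmod z0" if "eval_norm a [:- z, 1:] = eval_norm a [:- z0, 1:]" for z
    proof (rule z0(2))
      have "f z = f z1" using that f_z0 by (simp add: f_def)
      moreover have "z \<in> B"
        using large[of z] min[of 0] calculation by (force simp: B_def)
      ultimately show "z \<in> S" by (simp add: S_def)
    qed
  qed
qed

text \<open>If the minimum m of the quadratics were positive, attained at z0 with largest modulus, then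
  for h = (X - z0)(X - cnj z0), the factorisation of h^n - (-e)^n over the complex numbers
  would bound the value at a root z1 of h + e by m (1 + (e / m)^n)^2, hence by m.\<close>

lemma quadratic_real_annihilator:
  fixes a :: "'a::real_normed_field"
  shows "\<exists>r s. (a - of_real r)\<^sup>2 = - of_real (s\<^sup>2)"
proof -
  obtain z0 where z0: "\<And>z. eval_norm a [:- z0, 1:] \<le> eval_norm a [:- z, 1:]"
    "\<And>z. eval_norm a [:- z, 1:] = eval_norm a [:- z0, 1:] \<Longrightarrow> cmod z \<le> cmod z0"
    using eval_linear_attains_min by blast
  define m where "m = eval_norm a [:- z0, 1:]"
  have "m = 0"
  proof (rule ccontr)
    assume "m \<noteq> 0"
    then have m: "m > 0" by (simp add: m_def eval_norm_def)
    \<comment> \<open>Any value strictly between 0 and \<open>m\<close> would serve: what matters is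
      that \<open>(e / m) ^ n\<close> tends to 0.\<close>
    define e where "e = m / 2"
    have e: "e > 0" using m by (simp add: e_def)
    \<comment> \<open>With the real part of \<open>z0\<close> and a larger imaginary part,
      \<open>z1\<close> is too far from 0 to be a minimiser, and the quadratic \<open>h\<close>
      below takes the value \<open>- e\<close> there.\<close>
    define z1 where "z1 = Complex (Re z0) (sqrt ((Im z0)\<^sup>2 + e))"
    have "(cmod z1)\<^sup>2 = (cmod z0)\<^sup>2 + e"
      using e unfolding z1_def cmod_power2 by simp
    then have "cmod z1 > cmod z0"
      using e by (smt (verit) norm_ge_zero power_mono)
    then have f1: "eval_norm a [:- z1, 1:] > m"
      using z0(1)[of z1] z0(2)[of z1] by (force simp: m_def)
    define h where "h = [:(cmod z0)\<^sup>2, - 2 * Re z0, 1:]"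
    have bound: "eval_norm a [:- z1, 1:] \<le> m * (1 + (1/2) ^ n)\<^sup>2" if n: "n > 0" for n
    proof -
      define P where "P = h ^ n - [:(- e) ^ n:]"
      define Q where "Q = map_poly complex_of_real P"
      have dh: "degree h = 2" "lead_coeff h = 1" by (simp_all add: h_def)
      have dhn: "degree (h ^ n) = 2 * n" "lead_coeff (h ^ n) = 1"
        using dh by (simp_all only: lead_coeff_power) (simp_all add: degree_power_eq h_def)
      have dP: "degree P = 2 * n"
        using dhn n unfolding P_def diff_conv_add_uminus by (subst degree_add_eq_left) auto
      have "lead_coeff P = 1"
        unfolding dP using dhn n by (simp add: P_def coeff_pCons split: nat.splits)
      with dP have dQ: "degree Q = 2 * n" "lead_coeff Q = 1"
        by (simp_all add: Q_def degree_map_poly coeff_map_poly)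
      have ev: "poly (map_poly of_real P) b =
          ((b - of_real (Re z0))\<^sup>2 + of_real ((Im z0)\<^sup>2)) ^ n - of_real ((- e) ^ n)"
        for b :: "'b::real_normed_field"
      proof -
        have "poly (map_poly of_real h) b = (b - of_real (Re z0))\<^sup>2 + of_real ((Im z0)\<^sup>2)"
          unfolding h_def cmod_power2 by (simp add: map_poly_pCons power2_eq_square algebra_simps)
        then show ?thesis
          unfolding P_def diff_conv_add_uminus poly_map_of_real_add poly_map_of_real_power
          by (simp add: map_poly_pCons)
      qed
      have "(z1 - of_real (Re z0))\<^sup>2 = - of_real ((Im z0)\<^sup>2 + e)"
        using e by (simp add: complex_eq_iff z1_def power2_eq_square)
      then have "poly Q z1 = 0"
        unfolding Q_def ev by simp
      then obtain R where R: "Q = [:- z1, 1:] * R" by (auto simp: poly_eq_0_iff_dvd)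
      with dQ n have "R \<noteq> 0" by auto
      then have dR: "degree Q = Suc (degree R)" unfolding R by (subst degree_mult_eq) auto
      have lR: "lead_coeff Q = lead_coeff R" unfolding R by (simp only: lead_coeff_mult) simp
      \<comment> \<open>The cofactor \<open>R\<close> is monic of degree \<open>2 * n - 1\<close>.
        Against this lower bound stands the upper bound on \<open>eval_norm a Q\<close>, which rests
        on \<open>h\<close> having a value of norm exactly \<open>m\<close> at
        \<open>a\<close>.\<close>
      have "m ^ degree R \<le> eval_norm a R"
        using eval_norm_lower_bound[of m a R] z0(1) m lR dQ by (simp add: m_def)
      then have "eval_norm a [:- z1, 1:] * m ^ degree R \<le> eval_norm a Q"
        unfolding R eval_norm_mult by (intro mult_left_mono) (auto simp: eval_norm_def)
      then have 1: "eval_norm a [:- z1, 1:] * m ^ (2 * n) \<le> m * eval_norm a Q"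
        using m dR dQ by (simp add: mult.commute mult.left_commute)
      have "norm (poly (map_poly of_real P) a) \<le> m ^ n + e ^ n"
        unfolding ev m_def eval_norm_linear
        using e by (intro order_trans[OF norm_triangle_ineq4]) (simp add: norm_power)
      also have "m ^ n + e ^ n = m ^ n * (1 + (1/2) ^ n)"
        by (simp add: e_def power_divide algebra_simps)
      finally have "(norm (poly (map_poly of_real P) a))\<^sup>2 \<le> (m ^ n * (1 + (1/2) ^ n))\<^sup>2"
        by (intro power_mono) auto
      moreover have "eval_norm a Q = (norm (poly (map_poly of_real P) a))\<^sup>2"
        by (simp add: eval_norm_def Q_def eval_of_real_poly norm_power)
      ultimately have "m * eval_norm a Q \<le> m * (m ^ n * (1 + (1/2) ^ n))\<^sup>2"
        using m by simp
      with 1 have "eval_norm a [:- z1, 1:] * m ^ (2 * n) \<le> m * (m ^ n * (1 + (1/2) ^ n))\<^sup>2"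
        by (rule order_trans)
      also have "\<dots> = (m * (1 + (1/2) ^ n)\<^sup>2) * m ^ (2 * n)"
        by (simp add: power_mult_distrib power_mult[symmetric] mult_ac)
      finally have "eval_norm a [:- z1, 1:] * m ^ (2 * n) \<le> (m * (1 + (1/2) ^ n)\<^sup>2) * m ^ (2 * n)" .
      then show ?thesis using m by simp
    qed
    have "(\<lambda>n. m * (1 + (1/2) ^ n)\<^sup>2) \<longlonglongrightarrow> m * (1 + 0)\<^sup>2"
      by (intro tendsto_intros LIMSEQ_power_zero) simp
    then have "eval_norm a [:- z1, 1:] \<le> m * (1 + 0)\<^sup>2"
      by (rule LIMSEQ_le_const) (use bound in \<open>auto intro!: exI[of _ 1]\<close>)
    with f1 show False by simp
  qed
  then show ?thesis
    unfolding m_def eval_norm_linear by (auto simp: eq_neg_iff_add_eq_0)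
qed

text \<open>If some element gives \<open>s \<noteq> 0\<close>, rescaling yields \<open>j\<close>
  with square -1; then each \<open>b - r\<close> has the same square as a real multiple of
  \<open>j\<close>, hence equals it up to sign. Otherwise every element is real and
  \<open>j = 0\<close> serves.\<close>

lemma real_normed_field_two_dim:
  obtains j :: "'a::real_normed_field" where "\<And>b. \<exists>r s. b = of_real r + of_real s * j"
proof (cases "\<exists>a::'a. \<exists>r s. s \<noteq> 0 \<and> (a - of_real r)\<^sup>2 = - of_real (s\<^sup>2)")
  case True
  then obtain a :: 'a and r s where s: "s \<noteq> 0" "(a - of_real r)\<^sup>2 = - of_real (s\<^sup>2)" by blast
  define j where "j = (a - of_real r) / of_real s"
  have j: "j\<^sup>2 = -1" using s by (simp add: j_def power_divide)
  show ?thesis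
  proof (rule that[of j])
    fix b :: 'a
    obtain r s where "(b - of_real r)\<^sup>2 = - of_real (s\<^sup>2)"
      using quadratic_real_annihilator by blast
    then have "(b - of_real r)\<^sup>2 = (of_real s * j)\<^sup>2" by (simp add: power_mult_distrib j)
    then have "b - of_real r = of_real s * j \<or> b - of_real r = - (of_real s * j)"
      by (simp add: power2_eq_iff)
    then have "b = of_real r + of_real s * j \<or> b = of_real r + of_real (- s) * j"
      by (auto simp: algebra_simps)
    then show "\<exists>r s. b = of_real r + of_real s * j" by blast
  qed
next
  case False
  show ?thesis
  proof (rule that[of 0])
    fix b :: 'a
    obtain r s where "(b - of_real r)\<^sup>2 = - of_real (s\<^sup>2)"
      using quadratic_real_annihilator by blast
    with False have "(b - of_real r)\<^sup>2 = 0" by force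
    then show "\<exists>r s. b = of_real r + of_real s * 0" by auto
  qed
qed

lemma real_normed_field_separable:
  obtains D :: "'a::real_normed_field set"
  where "countable D" "\<And>b e. e > 0 \<Longrightarrow> \<exists>d\<in>D. norm (d - b) < e"
proof -
  obtain j :: 'a where j: "\<And>b. \<exists>r s. b = of_real r + of_real s * j"
    using real_normed_field_two_dim by blast
  define D where "D = (\<lambda>(q, q'). of_real q + of_real q' * j) ` (\<rat> \<times> \<rat>)"
  have "countable D" unfolding D_def by (intro countable_image countable_SIGMA countable_rat)
  moreover have "\<exists>d\<in>D. norm (d - b) < e" if e: "e > 0" for b e
  proof -
    obtain r s where b: "b = of_real r + of_real s * j" using j by blast
    have rat: "\<exists>q\<in>\<rat>. \<bar>q - t\<bar> < u" if "u > 0" for t u :: real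
    proof -
      obtain q where "q \<in> \<rat>" "t < q" "q < t + u"
        using Rats_dense_in_real[of t "t + u"] \<open>u > 0\<close> by auto
      then show ?thesis by (intro bexI[of _ q]) auto
    qed
    obtain q where q: "q \<in> \<rat>" "\<bar>q - r\<bar> < e / 2"
      using rat[of "e / 2" r] e by auto
    \<comment> \<open>The summand 1 keeps the denominator positive when
      \<open>j = 0\<close>.\<close>
    have "e / (2 * (norm j + 1)) > 0"
      using e by (simp add: add_nonneg_pos)
    then obtain q' where q': "q' \<in> \<rat>" "\<bar>q' - s\<bar> < e / (2 * (norm j + 1))"
      using rat by blast
    have "of_real q + of_real q' * j - b = of_real (q - r) + of_real (q' - s) * j"
      by (simp add: b algebra_simps)
    then have "norm (of_real q + of_real q' * j - b) \<le> \<bar>q - r\<bar> + \<bar>q' - s\<bar> * norm j"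
      by (metis norm_triangle_ineq norm_mult norm_of_real)
    also have "\<bar>q' - s\<bar> * norm j \<le> e / (2 * (norm j + 1)) * (norm j + 1)"
      using q' by (intro mult_mono) auto
    also have "\<dots> = e / 2"
      using norm_ge_zero[of j] by (simp add: divide_simps del: norm_ge_zero)
    finally have "norm (of_real q + of_real q' * j - b) < e" using q by simp
    then show ?thesis using q q' by (force simp: D_def)
  qed
  ultimately show ?thesis using that by blast
qed

section \<open>Return times and summability\<close>

text \<open>By contraposition: if the suprema exceeded each positive \<open>d\<close> only finitely
  often, they would tend to 0, and the density would be 0.\<close>

lemma upper_banach_density_pos_windows:
  assumes "upper_banach_density A > 0"
  obtains d where "d > 0"
    "infinite {N. \<exists>m. d * real (N + 1) \<le> real (card (A \<inter> {m..m + N}))}"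
proof -
  define f where "f N = (SUP m. real (card (A \<inter> {m..m + N})) / real (N + 1))" for N
  have le: "real (card (A \<inter> {m..m + N})) / real (N + 1) \<le> 1" for m N
  proof -
    have "card (A \<inter> {m..m + N}) \<le> card {m..m + N}" by (intro card_mono) auto
    then have "real (card (A \<inter> {m..m + N})) \<le> real (N + 1)" by simp
    then show ?thesis by simp
  qed
  have bdd: "bdd_above (range (\<lambda>m. real (card (A \<inter> {m..m + N})) / real (N + 1)))" for N
    using le[of _ N] by (intro bdd_aboveI2)
  have nonneg: "0 \<le> f N" for N
    unfolding f_def by (rule cSUP_upper2[OF bdd, of 0]) auto
  have "\<exists>d>0. infinite {N. d < f N}"
  proof (rule ccontr)
    assume "\<not> ?thesis"
    then have fin: "finite {N. d < f N}" if "d > 0" for d using that by blast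
    have "f \<longlonglongrightarrow> 0"
    proof (rule LIMSEQ_I)
      fix r :: real assume "r > 0"
      then have "finite {N. r / 2 < f N}" by (intro fin) simp
      then obtain N0 where "\<forall>N\<in>{N. r / 2 < f N}. N < N0"
        using finite_nat_set_iff_bounded by auto
      then have "f N \<le> r / 2" if "N \<ge> N0" for N using that by (intro leI notI) auto
      then show "\<exists>N0. \<forall>N\<ge>N0. norm (f N - 0) < r"
        using nonneg \<open>r > 0\<close> by (intro exI[of _ N0]) force
    qed
    then have "upper_banach_density A = 0"
      unfolding upper_banach_density_def f_def by (rule limI)
    with assms show False by simp
  qed
  then obtain d where d: "d > 0" "infinite {N. d < f N}" by blast
  have "{N. d < f N} \<subseteq> {N. \<exists>m. d * real (N + 1) \<le> real (card (A \<inter> {m..m + N}))}"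
  proof safe
    fix N assume "d < f N"
    then obtain m where "d < real (card (A \<inter> {m..m + N})) / real (N + 1)"
      unfolding f_def using less_cSUP_iff[OF _ bdd] by auto
    then show "\<exists>m. d * real (N + 1) \<le> real (card (A \<inter> {m..m + N}))"
      by (intro exI[of _ m]) (simp add: field_simps)
  qed
  with d show ?thesis using that infinite_super by blast
qed

section \<open>Popular differences of dense subsets of windows\<close>

definition pair_count :: "int set \<Rightarrow> int \<Rightarrow> nat" where
  "pair_count B t = card {n \<in> B. n + t \<in> B}"

text \<open>This autocorrelation of \<open>B\<close> measures the overlap of two translates, so
  unpopular differences correspond to almost disjoint translates.\<close>

lemma pair_count_eq_card_translates:
  "pair_count B (t - s) = card ((\<lambda>n. n + s) ` B \<inter> (\<lambda>n. n + t) ` B)"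
proof -
  have "(\<lambda>n. n + s) ` B \<inter> (\<lambda>n. n + t) ` B = (\<lambda>n. n + t) ` {n \<in> B. n + (t - s) \<in> B}"
  proof -
    have translate: "(\<lambda>n. n + s) ` C = {x. x - s \<in> C}" for s :: int and C
      by (auto intro: image_eqI[of _ _ "_ - s"])
    show ?thesis unfolding translate by auto
  qed
  then show ?thesis unfolding pair_count_def by (simp add: card_image inj_on_def)
qed

lemma pair_count_minus: "pair_count B (- t) = pair_count B t"
  using pair_count_eq_card_translates[of B 0 t] pair_count_eq_card_translates[of B t 0]
  by (simp add: Int_commute)

text \<open>A crude Bonferroni inequality: a set added to the union loses at most
  \<open>card T * v\<close> elements to the sets already there.\<close>

lemma card_UN_ge:
  fixes B :: "'i \<Rightarrow> 'b set"
  assumes "finite T" "\<And>t. t \<in> T \<Longrightarrow> finite (B t)" "\<And>t. t \<in> T \<Longrightarrow> u \<le> real (card (B t))"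
    "\<And>s t. s \<in> T \<Longrightarrow> t \<in> T \<Longrightarrow> s \<noteq> t \<Longrightarrow> real (card (B s \<inter> B t)) \<le> v" "0 \<le> v"
  shows "real (card T) * u - (real (card T))\<^sup>2 * v \<le> real (card (\<Union>t\<in>T. B t))"
  using assms(1-4)
proof (induction T rule: finite_induct)
  case (insert s T)
  let ?U = "\<Union>t\<in>T. B t"
  have "real (card (B s \<inter> ?U)) \<le> real (\<Sum>t\<in>T. card (B s \<inter> B t))"
    using insert.hyps by (simp only: Int_UN_distrib of_nat_le_iff card_UN_le)
  also have "\<dots> \<le> (\<Sum>t\<in>T. v)"
    unfolding of_nat_sum using insert by (intro sum_mono insert.prems) auto
  finally have "real (card (B s \<inter> ?U)) \<le> real (card T) * v" by simp
  moreover have "card (B s) + card ?U = card (B s \<union> ?U) + card (B s \<inter> ?U)"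
    using insert by (intro card_Un_Int) auto
  then have "real (card (B s)) + real (card ?U) = real (card (B s \<union> ?U)) + real (card (B s \<inter> ?U))"
    by (metis of_nat_add)
  moreover have "real (card T) * u - (real (card T))\<^sup>2 * v \<le> real (card ?U)"
    using insert by auto
  moreover have "u \<le> real (card (B s))" using insert by auto
  moreover have "real (card T) * v \<ge> 0" using \<open>0 \<le> v\<close> by simp
  moreover have "(real (card (insert s T)))\<^sup>2 * v = (real (card T))\<^sup>2 * v + 2 * (real (card T) * v) + v"
    "real (card (insert s T)) * u = real (card T) * u + u"
    using insert.hyps by (simp_all add: power2_eq_square algebra_simps)
  moreover have "card (\<Union>t\<in>insert s T. B t) = card (B s \<union> ?U)" by simp
  ultimately show ?case using \<open>0 \<le> v\<close> by linarith
qed simp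

text \<open>A packing argument: \<open>K\<close> translates would cover at least
  \<open>3/4 * K * d * (N + 1)\<close>, hence \<open>3/2 * (N + 1)\<close>, points of an interval of
  length \<open>N + 1 + 2 * S\<close>, where \<open>S\<close> bounds the shifts. This fails once
  \<open>N > 4 * S\<close>, and \<open>W\<close> is infinite.\<close>

lemma few_almost_disjoint_translates:
  fixes B :: "nat \<Rightarrow> int set" and m :: "nat \<Rightarrow> int"
  assumes d: "d > 0" "real K \<ge> 2 / d" and W: "infinite W"
    and sub: "\<And>N. N \<in> W \<Longrightarrow> B N \<subseteq> {m N..m N + int N}"
    and dens: "\<And>N. N \<in> W \<Longrightarrow> d * real (N + 1) \<le> real (card (B N))"
    and T: "finite T" "\<And>s t N. s \<in> T \<Longrightarrow> t \<in> T \<Longrightarrow> s \<noteq> t \<Longrightarrow> N \<in> W \<Longrightarrow>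
       real (pair_count (B N) (t - s)) < d / (4 * real K) * real (N + 1)"
  shows "card T < K"
proof (rule ccontr)
  assume "\<not> card T < K"
  then obtain T' where T': "T' \<subseteq> T" "card T' = K" "finite T'"
    by (meson not_less obtain_subset_with_card_n)
  have K: "real K > 0" using d by (smt (verit) divide_pos_pos)
  define S where "S = (\<Sum>t\<in>T'. \<bar>t\<bar>)"
  have S: "\<bar>t\<bar> \<le> S" if "t \<in> T'" for t
    unfolding S_def using T' that by (intro member_le_sum) auto
  have S0: "S \<ge> 0" unfolding S_def by (simp add: sum_nonneg)
  have "N \<in> {..nat (4 * S)}" if N: "N \<in> W" for N
  proof -
    let ?U = "\<Union>t\<in>T'. (\<lambda>n. n + t) ` B N"
    have finB: "finite (B N)" using sub[OF N] finite_subset by blast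
    have "real (card T') * (d * real (N + 1)) - (real (card T'))\<^sup>2 * (d / (4 * real K) * real (N + 1))
       \<le> real (card ?U)"
    proof (rule card_UN_ge)
      show "d * real (N + 1) \<le> real (card ((\<lambda>n. n + t) ` B N))" for t
        using dens[OF N] by (simp add: card_image inj_on_def)
      show "real (card ((\<lambda>n. n + s) ` B N \<inter> (\<lambda>n. n + t) ` B N)) \<le> d / (4 * real K) * real (N + 1)"
        if "s \<in> T'" "t \<in> T'" "s \<noteq> t" for s t
        unfolding pair_count_eq_card_translates[symmetric] using T(2)[of s t N] that T' N by force
    qed (use d finB T' in auto)
    also have "(real (card T'))\<^sup>2 * (d / (4 * real K) * real (N + 1)) = real K * d * real (N + 1) / 4"
      using K by (simp add: T' power2_eq_square)
    finally have "real K * (d * real (N + 1)) - real K * d * real (N + 1) / 4 \<le> real (card ?U)"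
      unfolding T' .
    moreover have "real K * (d * real (N + 1)) = real K * d * real (N + 1)"
      by simp
    ultimately have 1: "3 / 4 * (real K * d * real (N + 1)) \<le> real (card ?U)"
      by linarith
    have "?U \<subseteq> {m N - S..m N + int N + S}"
    proof safe
      fix t n assume "t \<in> T'" "n \<in> B N"
      then show "n + t \<in> {m N - S..m N + int N + S}"
        using sub[OF N] S[of t] by force
    qed
    then have "card ?U \<le> card {m N - S..m N + int N + S}" by (intro card_mono) auto
    then have "real (card ?U) \<le> real N + 1 + 2 * real_of_int S" using S0 by simp
    moreover have "2 * real (N + 1) \<le> (real K * d) * real (N + 1)"
      using d by (intro mult_right_mono) (auto simp: field_simps)
    ultimately have "real N \<le> 4 * real_of_int S" using 1 by simp
    then show ?thesis using S0 by simp
  qed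
  then have "W \<subseteq> {..nat (4 * S)}" by blast
  with W show False using finite_subset by blast
qed

text \<open>Double counting of the pairs in \<open>B\<close> by their difference; the hypothesis
  bounds the contribution of each first component.\<close>

lemma weighted_pair_count_le:
  fixes a :: "int \<Rightarrow> real"
  assumes "\<And>i. 0 \<le> a i" "finite B" "finite F" "\<And>n. n \<in> B \<Longrightarrow> (\<Sum>m\<in>B. a (m - n)) \<le> C"
  shows "(\<Sum>j\<in>F. real (pair_count B j) * a j) \<le> real (card B) * C"
proof -
  have "(\<Sum>j\<in>F. real (pair_count B j) * a j) = (\<Sum>j\<in>F. \<Sum>n\<in>B. if n + j \<in> B then a j else 0)"
    using assms(2) by (simp add: pair_count_def sum.If_cases Int_def)
  also have "\<dots> = (\<Sum>n\<in>B. \<Sum>j\<in>F. if n + j \<in> B then a j else 0)" by (rule sum.swap)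
  also have "\<dots> \<le> (\<Sum>n\<in>B. \<Sum>m\<in>B. a (m - n))"
  proof (rule sum_mono)
    fix n assume "n \<in> B"
    have "(\<Sum>j\<in>F. if n + j \<in> B then a j else 0) = (\<Sum>j\<in>{j\<in>F. n + j \<in> B}. a j)"
      using assms(3) by (simp add: sum.inter_filter)
    also have "\<dots> = (\<Sum>m\<in>(\<lambda>j. n + j) ` {j\<in>F. n + j \<in> B}. a (m - n))"
      by (subst sum.reindex) (auto simp: inj_on_def)
    also have "\<dots> \<le> (\<Sum>m\<in>B. a (m - n))"
      using assms by (intro sum_mono2) auto
    finally show "(\<Sum>j\<in>F. if n + j \<in> B then a j else 0) \<le> (\<Sum>m\<in>B. a (m - n))" .
  qed
  also have "\<dots> \<le> (\<Sum>n\<in>B. C)" by (intro sum_mono assms(4))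
  finally show ?thesis by simp
qed

lemma growth_iterate:
  fixes a :: "int \<Rightarrow> real"
  assumes "\<And>i. 0 \<le> a i" "\<And>i. a i \<le> L * a (i + 1)" "L \<ge> 1" "i \<le> i'" "nat (i' - i) \<le> D"
  shows "a i \<le> L ^ D * a i'"
proof -
  have "a i \<le> L ^ k * a (i + int k)" for k
  proof (induction k)
    case (Suc k)
    have "L ^ k * a (i + int k) \<le> L ^ k * (L * a (i + int k + 1))"
      using assms by (intro mult_left_mono) auto
    with Suc show ?case by (simp add: algebra_simps)
  qed simp
  from this[of "nat (i' - i)"] have "a i \<le> L ^ nat (i' - i) * a i'" using assms(4) by simp
  also have "\<dots> \<le> L ^ D * a i'" using assms by (intro mult_right_mono power_increasing) auto
  finally show ?thesis .
qed

text \<open>The families T and the sets of windows W are chosen together so that T is maximal for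
  W and all its infinite subsets; hence for each j, in all but finitely many windows of W
  some difference j - t with t in T is popular.\<close>

lemma summable_if_bounded_along_returns:
  fixes a :: "int \<Rightarrow> real" and A :: "nat set"
  assumes nonneg: "\<And>i. 0 \<le> a i" and growth: "\<And>i. a i \<le> L * a (i + 1)" and L: "L \<ge> 1"
    and bound: "\<And>n F. n \<in> A \<Longrightarrow> finite F \<Longrightarrow> F \<subseteq> A \<Longrightarrow> (\<Sum>m\<in>F. a (int m - int n)) \<le> C"
    and ubd: "upper_banach_density A > 0"
  shows "a summable_on UNIV"
proof -
  obtain d where d: "d > 0"
    and inf: "infinite {N. \<exists>m. d * real (N + 1) \<le> real (card (A \<inter> {m..m + N}))}"
    using upper_banach_density_pos_windows[OF ubd] by blast
  define W0 where "W0 = {N. \<exists>m. d * real (N + 1) \<le> real (card (A \<inter> {m..m + N}))}"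
  have "\<forall>N\<in>W0. \<exists>m. d * real (N + 1) \<le> real (card (A \<inter> {m..m + N}))" by (simp add: W0_def)
  then obtain m where m: "\<And>N. N \<in> W0 \<Longrightarrow> d * real (N + 1) \<le> real (card (A \<inter> {m N..m N + N}))"
    by metis
  define B where "B N = int ` (A \<inter> {m N..m N + N})" for N
  have sub: "B N \<subseteq> {int (m N)..int (m N) + int N}" for N by (auto simp: B_def)
  have finB: "finite (B N)" for N by (simp add: B_def)
  have dens: "d * real (N + 1) \<le> real (card (B N))" if "N \<in> W0" for N
    using m[OF that] by (simp add: B_def card_image)
  have cardB: "card (B N) \<le> N + 1" for N
    using card_mono[OF _ sub[of N]] by simp
  have sumB: "(\<Sum>l\<in>B N. a (l - n)) \<le> C" if "n \<in> B N" for n N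
  proof -
    obtain n' where n': "n' \<in> A" "n = int n'" using \<open>n \<in> B N\<close> by (auto simp: B_def)
    have "(\<Sum>l\<in>B N. a (l - n)) = (\<Sum>l\<in>A \<inter> {m N..m N + N}. a (int l - n))"
      unfolding B_def by (subst sum.reindex) auto
    also have "\<dots> \<le> C" unfolding n' by (rule bound) (use n' in auto)
    finally show ?thesis .
  qed
  define K where "K = nat \<lceil>2 / d\<rceil>"
  have K: "real K \<ge> 2 / d" by (simp add: K_def real_nat_ceiling_ge)
  then have Kpos: "real K > 0" using d by (smt (verit) divide_pos_pos)
  \<comment> \<open>The threshold for popularity is the overlap allowed in
    \<open>few_almost_disjoint_translates\<close>. Being at most \<open>d\<close>, it makes the
    difference 0 popular in every window.\<close>
  define c where "c = d / (4 * real K)"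
  have c: "c > 0" "c \<le> d" using d Kpos by (auto simp: c_def field_simps)
  define good where "good T W \<longleftrightarrow> finite T \<and> infinite W \<and> W \<subseteq> W0 \<and>
    (\<forall>s\<in>T. \<forall>t\<in>T. s \<noteq> t \<longrightarrow> (\<forall>N\<in>W. real (pair_count (B N) (t - s)) < c * real (N + 1)))"
    for T :: "int set" and W
  have "card T < K" if "good T W" for T W
    by (rule few_almost_disjoint_translates[OF d K, of W B "\<lambda>N. int (m N)" T])
      (use that sub dens in \<open>auto simp: good_def c_def subset_iff\<close>)
  then have bdd: "\<forall>k. (\<exists>T W. good T W \<and> card T = k) \<longrightarrow> k \<le> K"
    by (metis less_imp_le)
  have "good {} W0" using inf by (simp add: good_def W0_def)
  then have "\<exists>T W. good T W \<and> card T = 0" by (metis card.empty)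
  then obtain k where k: "\<exists>T W. good T W \<and> card T = k"
    "\<And>k'. \<exists>T W. good T W \<and> card T = k' \<Longrightarrow> k' \<le> k"
    using Nat.ex_has_greatest_nat[of "\<lambda>k. \<exists>T W. good T W \<and> card T = k" 0 K] bdd by blast
  then obtain T W where TW: "good T W" "card T = k" by blast
  have T: "finite T" and W: "infinite W" "W \<subseteq> W0" using TW by (auto simp: good_def)
  have fin: "finite {N \<in> W. \<forall>t\<in>T. real (pair_count (B N) (j - t)) < c * real (N + 1)}"
    (is "finite ?V") for j
  proof (rule ccontr)
    assume V: "infinite ?V"
    then have "?V \<noteq> {}" by (metis finite.emptyI)
    then obtain N where N: "N \<in> ?V" by blast
    \<comment> \<open>Otherwise the difference \<open>j - j = 0\<close> would be unpopular in the
      window \<open>N\<close>, although its pair count is the size of \<open>B N\<close>.\<close>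
    have "j \<notin> T"
    proof
      assume "j \<in> T"
      with N have "real (pair_count (B N) (j - j)) < c * real (N + 1)" by blast
      moreover have "pair_count (B N) (j - j) = card (B N)" by (simp add: pair_count_def)
      moreover have "c * real (N + 1) \<le> d * real (N + 1)" using c by (intro mult_right_mono) auto
      moreover have "d * real (N + 1) \<le> real (card (B N))" using N W by (intro dens) auto
      ultimately show False by linarith
    qed
    moreover have "good (insert j T) ?V"
      unfolding good_def
    proof (intro conjI ballI impI)
      fix s t N assume st: "s \<in> insert j T" "t \<in> insert j T" "s \<noteq> t" and N: "N \<in> ?V"
      have "pair_count (B N) (t - j) = pair_count (B N) (j - t)" for t
        using pair_count_minus[of "B N" "j - t"] by simp
      then show "real (pair_count (B N) (t - s)) < c * real (N + 1)"
        using st N TW(1) unfolding good_def by auto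
    qed (use T W V in auto)
    moreover have "card (insert j T) = Suc k" using \<open>j \<notin> T\<close> T TW by simp
    ultimately have "Suc k \<le> k" by (intro k(2)) blast
    then show False by simp
  qed
  define S where "S = (\<Sum>t\<in>T. \<bar>t\<bar>)"
  have S: "\<bar>t\<bar> \<le> S" if "t \<in> T" for t
    unfolding S_def using T that by (intro member_le_sum) auto
  \<comment> \<open>The shift by \<open>S\<close> puts \<open>j - S\<close> at or below
    \<open>j - t\<close> for every \<open>t\<close> in \<open>T\<close>, at distance at most
    \<open>2 * S\<close>. The growth condition then compares the weights whichever \<open>t\<close>
    makes the difference popular.\<close>
  have "(\<lambda>j. a (j - S)) summable_on UNIV"
  proof (rule nonneg_bdd_above_summable_on)
    show "bdd_above (sum (\<lambda>j. a (j - S)) ` {F. F \<subseteq> UNIV \<and> finite F})"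
    proof (rule bdd_aboveI2)
      fix F :: "int set" assume "F \<in> {F. F \<subseteq> UNIV \<and> finite F}"
      then have F: "finite F" by simp
      \<comment> \<open>Each \<open>j\<close> excludes only finitely many windows, so one window of
        \<open>W\<close> serves all of \<open>F\<close> at once. Its length cancels at the end,
        leaving a bound independent of \<open>F\<close>.\<close>
      have "finite (\<Union>j\<in>F. {N \<in> W. \<forall>t\<in>T. real (pair_count (B N) (j - t)) < c * real (N + 1)})"
        using F fin by blast
      then have "infinite (W - (\<Union>j\<in>F. {N \<in> W. \<forall>t\<in>T. real (pair_count (B N) (j - t)) < c * real (N + 1)}))"
        using W(1) by (rule Diff_infinite_finite)
      then obtain N where N: "N \<in> W"
        and "N \<notin> (\<Union>j\<in>F. {N \<in> W. \<forall>t\<in>T. real (pair_count (B N) (j - t)) < c * real (N + 1)})"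
        by (metis (no_types, lifting) DiffE equals0I finite.emptyI)
      then have ex: "\<exists>t\<in>T. c * real (N + 1) \<le> real (pair_count (B N) (j - t))" if "j \<in> F" for j
        using that by force
      let ?M = "L ^ nat (2 * S)"
      have "c * real (N + 1) * a (j - S) \<le> ?M * (\<Sum>t\<in>T. real (pair_count (B N) (j - t)) * a (j - t))"
        if j: "j \<in> F" for j
      proof -
        obtain t where t: "t \<in> T" "c * real (N + 1) \<le> real (pair_count (B N) (j - t))"
          using ex j by blast
        have "a (j - S) \<le> ?M * a (j - t)"
          using S[OF t(1)] by (intro growth_iterate nonneg growth L) auto
        then have "c * real (N + 1) * a (j - S) \<le> real (pair_count (B N) (j - t)) * (?M * a (j - t))"
          using t nonneg by (intro mult_mono) auto
        also have "\<dots> = ?M * (real (pair_count (B N) (j - t)) * a (j - t))" by simp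
        also have "\<dots> \<le> ?M * (\<Sum>t\<in>T. real (pair_count (B N) (j - t)) * a (j - t))"
          using t T L nonneg by (intro mult_left_mono member_le_sum) auto
        finally show ?thesis .
      qed
      then have "(\<Sum>j\<in>F. c * real (N + 1) * a (j - S))
          \<le> (\<Sum>j\<in>F. ?M * (\<Sum>t\<in>T. real (pair_count (B N) (j - t)) * a (j - t)))"
        by (rule sum_mono)
      also have "\<dots> = ?M * (\<Sum>t\<in>T. \<Sum>j\<in>F. real (pair_count (B N) (j - t)) * a (j - t))"
        unfolding sum_distrib_left[symmetric] by (subst sum.swap) simp
      also have "\<dots> \<le> ?M * (\<Sum>t\<in>T. real (N + 1) * \<bar>C\<bar>)"
      proof (intro mult_left_mono sum_mono)
        fix t
        have "(\<Sum>j\<in>F. real (pair_count (B N) (j - t)) * a (j - t))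
           = (\<Sum>j\<in>(\<lambda>j. j - t) ` F. real (pair_count (B N) j) * a j)"
          by (subst sum.reindex) (auto simp: inj_on_def)
        also have "\<dots> \<le> real (card (B N)) * C"
          using F by (intro weighted_pair_count_le nonneg finB sumB) auto
        also have "\<dots> \<le> real (card (B N)) * \<bar>C\<bar>"
          by (intro mult_left_mono) auto
        also have "\<dots> \<le> real (N + 1) * \<bar>C\<bar>"
          using cardB[of N] by (intro mult_right_mono) (simp_all only: of_nat_le_iff abs_ge_zero)
        finally show "(\<Sum>j\<in>F. real (pair_count (B N) (j - t)) * a (j - t)) \<le> real (N + 1) * \<bar>C\<bar>" .
      qed (use L in auto)
      also have "\<dots> = (c * real (N + 1)) * (?M * real (card T) * \<bar>C\<bar> / c)" using c by simp
      finally have "(c * real (N + 1)) * (\<Sum>j\<in>F. a (j - S)) \<le> (c * real (N + 1)) * (?M * real (card T) * \<bar>C\<bar> / c)"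
        by (simp only: sum_distrib_left)
      then show "(\<Sum>j\<in>F. a (j - S)) \<le> ?M * real (card T) * \<bar>C\<bar> / c"
        using c by (subst (asm) mult_le_cancel_left_pos) auto
    qed
  qed (use nonneg in auto)
  then show ?thesis
    using summable_on_reindex_bij_betw[of "\<lambda>j. j - S" UNIV UNIV a]
      bij_betw_byWitness[of UNIV "\<lambda>j. j + S" "\<lambda>j. j - S" UNIV] by simp
qed

section \<open>The fixed vector of a weighted shift\<close>

lemma summable_tail_finite:
  fixes f :: "'b \<Rightarrow> real"
  assumes "f summable_on UNIV" "\<And>i. 0 \<le> f i" "c > 0"
  obtains G where "finite G" "\<And>F. finite F \<Longrightarrow> F \<inter> G = {} \<Longrightarrow> sum f F \<le> c"
proof -
  have "(sum f \<longlongrightarrow> infsum f UNIV) (finite_subsets_at_top UNIV)"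
    using assms(1) has_sum_infsum has_sum_def by blast
  then have "\<forall>\<^sub>F G in finite_subsets_at_top UNIV. infsum f UNIV - c < sum f G"
    using assms(3) by (intro order_tendstoD) auto
  then obtain G where G: "finite G" "infsum f UNIV - c < sum f G"
    unfolding eventually_finite_subsets_at_top by blast
  have "sum f F \<le> c" if "finite F" "F \<inter> G = {}" for F
  proof -
    have "sum f F + sum f G = sum f (F \<union> G)" using that G by (simp add: sum.union_disjoint)
    also have "\<dots> \<le> infsum f UNIV"
      using that G assms by (intro finite_sum_le_infsum) auto
    finally show ?thesis using G by simp
  qed
  with G show ?thesis using that by blast
qed

lemma summable_tail_radius:
  fixes f :: "int \<Rightarrow> real"
  assumes "f summable_on UNIV" "\<And>i. 0 \<le> f i" "c > 0"
  obtains r where "\<And>F. finite F \<Longrightarrow> (\<And>i. i \<in> F \<Longrightarrow> r \<le> nat \<bar>i\<bar>) \<Longrightarrow> sum f F \<le> c"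
proof -
  obtain G where G: "finite G" "\<And>F. finite F \<Longrightarrow> F \<inter> G = {} \<Longrightarrow> sum f F \<le> c"
    using summable_tail_finite[OF assms] by blast
  obtain r where r: "\<forall>k\<in>(\<lambda>i. nat \<bar>i\<bar>) ` G. k < r"
    using G(1) finite_nat_set_iff_bounded by (metis finite_imageI)
  show ?thesis
  proof (rule that)
    fix F assume F: "finite F" "\<And>i. i \<in> F \<Longrightarrow> r \<le> nat \<bar>i\<bar>"
    show "sum f F \<le> c"
    proof (rule G(2)[OF F(1)], rule ccontr)
      assume "F \<inter> G \<noteq> {}"
      then obtain i where "i \<in> F" "i \<in> G" by blast
      with r F(2)[of i] show False by force
    qed
  qed
qed

lemma norm_diff_powr_le:
  fixes u v :: "'a::real_normed_vector"
  assumes "0 \<le> p"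
  shows "norm (u - v) powr p \<le> 2 powr p * (norm u powr p + norm v powr p)"
proof -
  have "norm (u - v) \<le> 2 * max (norm u) (norm v)"
    using norm_triangle_ineq4[of u v] by linarith
  then have "norm (u - v) powr p \<le> (2 * max (norm u) (norm v)) powr p"
    using assms by (intro powr_mono2) auto
  also have "\<dots> = 2 powr p * max (norm u) (norm v) powr p" by (subst powr_mult) auto
  also have "\<dots> \<le> 2 powr p * (norm u powr p + norm v powr p)"
    by (intro mult_left_mono) (auto simp: max_def)
  finally show ?thesis .
qed

lemma sum_norm_diff_powr_le:
  fixes u v t :: "'b \<Rightarrow> 'a::real_normed_vector"
  assumes "0 \<le> p" "(\<Sum>i\<in>F. norm (u i - t i) powr p) \<le> c" "(\<Sum>i\<in>F. norm (v i - t i) powr p) \<le> d"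
  shows "(\<Sum>i\<in>F. norm (u i - v i) powr p) \<le> 2 powr p * (c + d)"
proof -
  have "norm (u i - v i) powr p \<le> 2 powr p * (norm (u i - t i) powr p + norm (v i - t i) powr p)" for i
    using norm_diff_powr_le[OF assms(1), of "u i - t i" "v i - t i"] by simp
  then have "(\<Sum>i\<in>F. norm (u i - v i) powr p)
      \<le> (\<Sum>i\<in>F. 2 powr p * (norm (u i - t i) powr p + norm (v i - t i) powr p))"
    by (rule sum_mono)
  also have "\<dots> = 2 powr p * ((\<Sum>i\<in>F. norm (u i - t i) powr p) + (\<Sum>i\<in>F. norm (v i - t i) powr p))"
    by (simp only: sum_distrib_left[symmetric] sum.distrib)
  also have "\<dots> \<le> 2 powr p * (c + d)"
    using assms by (intro mult_left_mono) auto
  finally show ?thesis .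
qed

lemma lp_dist_lessI:
  assumes "p \<ge> 1" "r > 0" "c < r powr p" "\<And>F. finite F \<Longrightarrow> (\<Sum>i\<in>F. norm (u i - v i) powr p) \<le> c"
  shows "lp_dist p u v < r"
proof -
  let ?f = "\<lambda>i. norm ((u - v) i) powr p"
  have "?f summable_on UNIV"
    using assms(4) by (intro nonneg_bdd_above_summable_on) (auto intro!: bdd_aboveI2[where M = c])
  then have "infsum ?f UNIV \<le> c"
    using assms(4) by (intro infsum_le_finite_sums) auto
  then have "infsum ?f UNIV powr (1 / p) \<le> c powr (1 / p)"
    using assms by (intro powr_mono2 infsum_nonneg) auto
  also have "\<dots> < (r powr p) powr (1 / p)"
    using assms assms(4)[of "{}"] by (intro powr_less_mono2) auto
  also have "\<dots> = r" using assms by (simp add: powr_powr)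
  finally show ?thesis by (simp add: lp_dist_def lp_norm_def)
qed

lemma lp_space_diff_summable:
  assumes "0 \<le> p" "u \<in> lp_space I p" "v \<in> lp_space I p"
  shows "(\<lambda>i. norm (u i - v i) powr p) summable_on UNIV"
proof -
  have "(\<lambda>i. 2 powr p * (norm (u i) powr p + norm (v i) powr p)) summable_on UNIV"
    using assms by (intro summable_on_cmult_right summable_on_add) (auto simp: lp_space_def)
  then show ?thesis
    by (rule summable_on_comparison_test) (use assms norm_diff_powr_le in auto)
qed

lemma sum_le_if_lp_dist_less:
  assumes "p \<ge> 1" "u \<in> lp_space I p" "v \<in> lp_space I p" "lp_dist p u v < r" "finite F"
  shows "(\<Sum>i\<in>F. norm (u i - v i) powr p) \<le> r powr p"
proof -
  let ?f = "\<lambda>i. norm (u i - v i) powr p"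
  have "sum ?f F \<le> infsum ?f UNIV"
    using lp_space_diff_summable[of p u I v] assms by (intro finite_sum_le_infsum) auto
  also have "\<dots> = (infsum ?f UNIV powr (1 / p)) powr p"
    using assms by (simp add: powr_powr infsum_nonneg)
  also have "infsum ?f UNIV powr (1 / p) = lp_dist p u v"
    by (simp add: lp_dist_def lp_norm_def)
  also have "lp_dist p u v powr p \<le> r powr p"
    using assms by (intro powr_mono2) (auto simp: lp_dist_def lp_norm_def)
  finally show ?thesis .
qed

lemma weighted_shift_fixed_vector:
  fixes w :: "int \<Rightarrow> 'a::real_normed_field"
  assumes I: "I = {0..} \<or> I = UNIV" and w_nz: "\<And>n. n - 1 \<in> I \<Longrightarrow> w n \<noteq> 0"
  obtains e where "\<And>n. n \<in> I \<Longrightarrow> e n \<noteq> 0" "\<And>n. n \<notin> I \<Longrightarrow> e n = 0"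
    "\<And>n. n \<in> I \<Longrightarrow> w (n + 1) * e (n + 1) = e n"
proof -
  define e where "e n = (if n \<notin> I then 0 else if n \<ge> 0 then inverse (\<Prod>k\<in>{1..n}. w k)
     else (\<Prod>k\<in>{n + 1..0}. w k))" for n
  show ?thesis
  proof (rule that[of e])
    fix n assume n: "n \<in> I"
    have nz: "w k \<noteq> 0" if "k \<ge> 1 \<or> n < 0" for k
      using that I n by (intro w_nz) auto
    show "e n \<noteq> 0" using n nz by (auto simp: e_def)
    have n1: "n + 1 \<in> I" using I n by auto
    show "w (n + 1) * e (n + 1) = e n"
    proof (cases "n \<ge> 0")
      case True
      then have "{1..n + 1} = insert (n + 1) {1..n}" by auto
      then show ?thesis using True n n1 nz[of "n + 1"] by (simp add: e_def)
    next
      case False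
      then have "{n + 1..0} = insert (n + 1) {n + 2..0}" by auto
      then show ?thesis using False n n1 by (cases "n = -1") (auto simp: e_def add.commute)
    qed
  qed (simp add: e_def)
qed

lemma bw_shift_funpow:
  assumes "\<And>n. n \<notin> I \<Longrightarrow> e n = 0" "\<And>n. n \<in> I \<Longrightarrow> w (n + 1) * e (n + 1) = e n"
  shows "(bw_shift I w ^^ k) (\<lambda>i. e i * \<xi> i) = (\<lambda>i. e i * \<xi> (i + int k))"
proof (induction k)
  case (Suc k)
  have "bw_shift I w (\<lambda>i. e i * \<xi> (i + int k)) = (\<lambda>i. e i * \<xi> (i + int (Suc k)))"
  proof
    fix i
    show "bw_shift I w (\<lambda>i. e i * \<xi> (i + int k)) i = e i * \<xi> (i + int (Suc k))"
      using assms by (cases "i \<in> I") (simp_all add: bw_shift_def mult.assoc[symmetric], simp add: add_ac)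
  qed
  with Suc show ?case by simp
qed simp

lemma weights_bounded:
  fixes w :: "int \<Rightarrow> 'a::real_normed_field"
  assumes p: "1 \<le> p" and I: "I = {0..} \<or> I = UNIV"
    and C: "\<forall>z \<in> lp_space I p. lp_norm p (bw_shift I w z) \<le> C * lp_norm p z"
    and i: "i \<in> I"
  shows "norm (w (i + 1)) \<le> C"
proof -
  have single: "((\<lambda>n. norm (if n = j then c else 0 :: 'a) powr p) has_sum norm c powr p) UNIV"
    for j :: int and c
    by (rule has_sum_finite_neutralI[of "{j}"]) auto
  have norm_single: "lp_norm p (\<lambda>n. if n = j then c else 0) = norm c" for j :: int and c :: 'a
    using p unfolding lp_norm_def infsumI[OF single] by (simp add: powr_powr)
  let ?z = "\<lambda>n. if n = i + 1 then 1 else 0 :: 'a"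
  have "?z \<in> lp_space I p"
    using I i single[of "i + 1" 1] has_sum_imp_summable[OF single[of "i + 1" 1]]
    by (auto simp: lp_space_def)
  moreover have "bw_shift I w ?z = (\<lambda>n. if n = i then w (i + 1) else 0)"
    using i by (auto simp: bw_shift_def)
  ultimately show ?thesis using C norm_single[of "i + 1" 1] norm_single[of i "w (i + 1)"] by force
qed

lemma fixed_vector_summable:
  fixes w :: "int \<Rightarrow> 'a::real_normed_field"
  assumes p: "1 \<le> p" and I: "I = {0..} \<or> I = UNIV"
    and e: "\<And>n. n \<in> I \<Longrightarrow> e n \<noteq> 0" "\<And>n. n \<notin> I \<Longrightarrow> e n = 0"
       "\<And>n. n \<in> I \<Longrightarrow> w (n + 1) * e (n + 1) = e n"
    and bounded: "\<exists>C. \<forall>z \<in> lp_space I p. lp_norm p (bw_shift I w z) \<le> C * lp_norm p z"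
    and x: "x \<in> lp_space I p"
    and y: "y \<in> lp_space I p" "y k \<noteq> 0"
    and ubd: "\<And>V. nbhd_in (lp_space I p) (lp_dist p) y V \<Longrightarrow>
               upper_banach_density {n. (bw_shift I w ^^ n) x \<in> V} > 0"
  shows "(\<lambda>i. norm (e i) powr p) summable_on UNIV"
proof -
  define a where "a i = norm (e i) powr p" for i
  define \<xi> where "\<xi> i = x i / e i" for i
  have x_eq: "x = (\<lambda>i. e i * \<xi> i)"
    using e(1,2) x by (force simp: \<xi>_def lp_space_def)
  have orbit: "(bw_shift I w ^^ n) x = (\<lambda>i. e i * \<xi> (i + int n))" for n
    unfolding x_eq by (rule bw_shift_funpow) (use e in auto)
  obtain C where C: "\<forall>z \<in> lp_space I p. lp_norm p (bw_shift I w z) \<le> C * lp_norm p z"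
    using bounded by blast
  define L where "L = max 1 C powr p"
  have L: "L \<ge> 1" using p by (simp add: L_def ge_one_powr_ge_zero)
  have growth: "a i \<le> L * a (i + 1)" for i
  proof (cases "i \<in> I")
    case True
    have "norm (w (i + 1)) powr p \<le> L"
      unfolding L_def using weights_bounded[OF p I C True] p by (intro powr_mono2) auto
    moreover have "a i = norm (w (i + 1)) powr p * a (i + 1)"
      using e(3)[OF True, symmetric] by (simp add: a_def norm_mult powr_mult)
    ultimately show ?thesis by (simp add: a_def mult_right_mono)
  qed (use e L in \<open>simp add: a_def\<close>)
  have k: "k \<in> I" using y by (auto simp: lp_space_def)
  define r where "r = norm (y k) / 2"
  have r: "r > 0" using y by (simp add: r_def)
  define V where "V = open_ball_in (lp_space I p) (lp_dist p) y r"
  define A where "A = {n. (bw_shift I w ^^ n) x \<in> V}"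
  have A: "upper_banach_density A > 0"
    unfolding A_def using r by (intro ubd) (auto simp: nbhd_in_def V_def)
  have near: "(\<Sum>i\<in>F. norm (e i * \<xi> (i + int n) - y i) powr p) \<le> r powr p" if "n \<in> A" "finite F" for n F
    using sum_le_if_lp_dist_less[OF p _ y(1) _ that(2), of "(bw_shift I w ^^ n) x" r] that(1)
    unfolding A_def V_def open_ball_in_def by (simp add: orbit)
  define \<delta> where "\<delta> = r / norm (e k)"
  have \<delta>: "\<delta> > 0" using r e k by (simp add: \<delta>_def)
  have large: "norm (\<xi> (k + int n)) \<ge> \<delta>" if "n \<in> A" for n
  proof -
    have "norm (e k * \<xi> (k + int n) - y k) powr p \<le> r powr p"
      using near[OF that, of "{k}"] by simp
    then have "norm (e k * \<xi> (k + int n) - y k) \<le> r"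
      using powr_less_mono2[of p r "norm (e k * \<xi> (k + int n) - y k)"] p r by force
    moreover have "norm (y k) \<le> norm (e k * \<xi> (k + int n)) + norm (e k * \<xi> (k + int n) - y k)"
      by (metis norm_minus_commute norm_triangle_sub)
    ultimately have "r \<le> norm (e k) * norm (\<xi> (k + int n))"
      by (simp add: r_def norm_mult)
    then show ?thesis using e(1)[OF k] by (simp add: \<delta>_def field_simps)
  qed
  define Y where "Y = infsum (\<lambda>i. norm (y i) powr p) UNIV"
  have "(\<lambda>i. a (k + i)) summable_on UNIV"
  proof (rule summable_if_bounded_along_returns[where A = A and L = L
        and C = "2 powr p * (r powr p + Y) / \<delta> powr p"])
    fix n F assume n: "n \<in> A" and F: "finite F" "F \<subseteq> A"
    define G where "G = (\<lambda>m. k + (int m - int n)) ` F"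
    have "\<delta> powr p * (\<Sum>m\<in>F. a (k + (int m - int n))) \<le>
        (\<Sum>m\<in>F. norm (e (k + (int m - int n)) * \<xi> (k + int m)) powr p)"
      unfolding sum_distrib_left
    proof (rule sum_mono)
      fix m assume "m \<in> F"
      then have "\<delta> powr p \<le> norm (\<xi> (k + int m)) powr p"
        using large F \<delta> p by (intro powr_mono2) auto
      then have "\<delta> powr p * a (k + (int m - int n)) \<le> norm (\<xi> (k + int m)) powr p * a (k + (int m - int n))"
        by (intro mult_right_mono) (auto simp: a_def)
      then show "\<delta> powr p * a (k + (int m - int n)) \<le> norm (e (k + (int m - int n)) * \<xi> (k + int m)) powr p"
        by (simp add: a_def norm_mult powr_mult mult.commute)
    qed
    also have "\<dots> = (\<Sum>i\<in>G. norm (e i * \<xi> (i + int n) - 0) powr p)"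
      unfolding G_def by (subst sum.reindex) (auto simp: inj_on_def)
    also have "\<dots> \<le> 2 powr p * (r powr p + Y)"
    proof (rule sum_norm_diff_powr_le[where t = y])
      show "(\<Sum>i\<in>G. norm (e i * \<xi> (i + int n) - y i) powr p) \<le> r powr p"
        using F by (intro near n) (simp add: G_def)
      show "(\<Sum>i\<in>G. norm (0 - y i) powr p) \<le> Y"
        unfolding Y_def using y F by (simp only: diff_0 norm_minus_cancel)
          (intro finite_sum_le_infsum, auto simp: lp_space_def G_def)
    qed (use p in auto)
    finally show "(\<Sum>m\<in>F. a (k + (int m - int n))) \<le> 2 powr p * (r powr p + Y) / \<delta> powr p"
      using \<delta> by (simp add: field_simps)
  qed (use growth[of "k + _"] L A in \<open>auto simp: a_def add.assoc\<close>)
  then show ?thesis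
    using summable_on_reindex_bij_betw[of "\<lambda>i. k + i" UNIV UNIV a]
      bij_betw_byWitness[of UNIV "\<lambda>j. j - k" "\<lambda>j. k + j" UNIV] by (simp add: a_def[abs_def])
qed

section \<open>Positions of the blocks\<close>

lemma slow_weight_exists:
  fixes a :: "int \<Rightarrow> real"
  assumes a: "a summable_on UNIV" "\<And>i. 0 \<le> a i"
  obtains h :: "nat \<Rightarrow> nat" where "mono h" "\<And>m. h m \<le> m" "\<And>l. \<exists>m. l \<le> h m"
    "(\<lambda>i. a i * real (h (nat \<bar>i\<bar>)) powr p) summable_on UNIV"
proof -
  define c where "c l = (1/2) ^ l / real (Suc l) powr p" for l
  have "\<exists>r. \<forall>F. finite F \<longrightarrow> (\<forall>i\<in>F. r \<le> nat \<bar>i\<bar>) \<longrightarrow> sum a F \<le> c l" for l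
    using summable_tail_radius[OF a, of "c l"] by (metis c_def divide_pos_pos half_gt_zero_iff
        of_nat_0_less_iff powr_gt_zero zero_less_Suc zero_less_numeral zero_less_one zero_less_power less_irrefl)
  then obtain r where r: "\<And>l F. finite F \<Longrightarrow> (\<And>i. i \<in> F \<Longrightarrow> r l \<le> nat \<bar>i\<bar>) \<Longrightarrow> sum a F \<le> c l"
    by metis
  define S where "S m = insert 0 {Suc l | l. Suc l \<le> m \<and> r l \<le> m}" for m
  define h where "h m = Max (S m)" for m
  have S: "finite (S m)" "S m \<noteq> {}" for m
    by (auto simp: S_def intro: finite_subset[of _ "{..m}"])
  have h_in: "h m \<in> S m" for m unfolding h_def using S by (rule Max_in)
  have "mono h"
    unfolding h_def by (intro monoI Max_mono S) (auto simp: S_def)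
  moreover have "h m \<le> m" for m using h_in[of m] by (auto simp: S_def)
  moreover have "\<exists>m. l \<le> h m" for l
  proof
    have "Suc l \<le> h (max (Suc l) (r l))"
      unfolding h_def by (intro Max_ge S) (auto simp: S_def)
    then show "l \<le> h (max (Suc l) (r l))" by simp
  qed
  moreover have "(\<lambda>i. a i * real (h (nat \<bar>i\<bar>)) powr p) summable_on UNIV"
  proof (rule nonneg_bdd_above_summable_on)
    show "bdd_above (sum (\<lambda>i. a i * real (h (nat \<bar>i\<bar>)) powr p) ` {F. F \<subseteq> UNIV \<and> finite F})"
    proof (rule bdd_aboveI2)
      fix F :: "int set" assume "F \<in> {F. F \<subseteq> UNIV \<and> finite F}"
      then have F: "finite F" by simp
      then obtain M where M: "\<And>i. i \<in> F \<Longrightarrow> nat \<bar>i\<bar> < M"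
        using finite_nat_set_iff_bounded[of "(\<lambda>i. nat \<bar>i\<bar>) ` F"] by auto
      have "(\<Sum>i\<in>F. a i * real (h (nat \<bar>i\<bar>)) powr p)
         \<le> (\<Sum>i\<in>F. \<Sum>l<M. if r l \<le> nat \<bar>i\<bar> then a i * real (Suc l) powr p else 0)"
      proof (rule sum_mono)
        fix i assume i: "i \<in> F"
        have nn: "0 \<le> (if r l \<le> nat \<bar>i\<bar> then a i * real (Suc l) powr p else 0)" for l
          using a(2) by auto
        show "a i * real (h (nat \<bar>i\<bar>)) powr p
            \<le> (\<Sum>l<M. if r l \<le> nat \<bar>i\<bar> then a i * real (Suc l) powr p else 0)"
        proof (cases "h (nat \<bar>i\<bar>)")
          case 0
          then show ?thesis using nn by (simp add: sum_nonneg)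
        next
          case (Suc l)
          with h_in[of "nat \<bar>i\<bar>"] have l: "Suc l \<le> nat \<bar>i\<bar>" "r l \<le> nat \<bar>i\<bar>" by (auto simp: S_def)
          then have "a i * real (h (nat \<bar>i\<bar>)) powr p = (if r l \<le> nat \<bar>i\<bar> then a i * real (Suc l) powr p else 0)"
            using Suc by simp
          also have "\<dots> \<le> (\<Sum>l<M. if r l \<le> nat \<bar>i\<bar> then a i * real (Suc l) powr p else 0)"
            using l M[OF i] nn by (intro member_le_sum) auto
          finally show ?thesis .
        qed
      qed
      also have "\<dots> = (\<Sum>l<M. \<Sum>i\<in>F. if r l \<le> nat \<bar>i\<bar> then a i * real (Suc l) powr p else 0)"
        by (rule sum.swap)
      also have "\<dots> \<le> (\<Sum>l<M. (1/2) ^ l)"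
      proof (rule sum_mono)
        fix l
        have "(\<Sum>i\<in>F. if r l \<le> nat \<bar>i\<bar> then a i * real (Suc l) powr p else 0)
           = (\<Sum>i\<in>{i\<in>F. r l \<le> nat \<bar>i\<bar>}. a i) * real (Suc l) powr p"
          using F by (simp add: sum.inter_filter[symmetric] sum_distrib_right)
        also have "\<dots> \<le> c l * real (Suc l) powr p"
          using F by (intro mult_right_mono r) auto
        also have "\<dots> = (1/2) ^ l" by (simp add: c_def)
        finally show "(\<Sum>i\<in>F. if r l \<le> nat \<bar>i\<bar> then a i * real (Suc l) powr p else 0) \<le> (1/2) ^ l" .
      qed
      also have "\<dots> \<le> (\<Sum>l. (1/2) ^ l :: real)"
        by (intro sum_le_suminf summable_geometric) auto
      finally show "(\<Sum>i\<in>F. a i * real (h (nat \<bar>i\<bar>)) powr p) \<le> (\<Sum>l. (1/2) ^ l)" .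
    qed
  qed (use a in auto)
  ultimately show ?thesis using that by blast
qed

fun ruler :: "nat \<Rightarrow> nat" where
  "ruler n = (if n = 0 \<or> odd n then 0 else Suc (ruler (n div 2)))"

declare ruler.simps [simp del]

lemma ruler_power_mult: "ruler (2 ^ m * (2 * t + 1)) = m"
proof (induction m)
  case 0
  then show ?case by (subst ruler.simps) simp
next
  case (Suc m)
  have "ruler (2 * k) = Suc (ruler k)" if "k > 0" for k
    using that by (subst ruler.simps) simp
  from this[of "2 ^ m * (2 * t + 1)"] Suc show ?case by (simp only: power_Suc mult.assoc) simp
qed

lemma sum_ruler_le: "(\<Sum>i\<le>n. ruler i) \<le> n"
proof (induction n rule: less_induct)
  case (less n)
  have double: "(\<Sum>i\<le>2 * k + 1. ruler i) = k + (\<Sum>i\<le>k. ruler i)" for k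
  proof (induction k)
    case 0
    then show ?case by (simp add: ruler.simps)
  next
    case (Suc k)
    have "2 * Suc k + 1 = Suc (Suc (2 * k + 1))" by simp
    then have "(\<Sum>i\<le>2 * Suc k + 1. ruler i)
        = (\<Sum>i\<le>2 * k + 1. ruler i) + ruler (2 * k + 2) + ruler (2 * k + 3)"
      by (simp add: eval_nat_numeral)
    moreover have "ruler (2 * k + 3) = 0" by (simp add: ruler.simps)
    moreover have "ruler (2 * k + 2) = Suc (ruler (Suc k))" by (subst ruler.simps) simp
    ultimately show ?case using Suc by simp
  qed
  show ?case
  proof (cases "n \<le> 1")
    case True
    then have "n = 0 \<or> n = 1" by auto
    then show ?thesis by (auto simp: ruler.simps)
  next
    case False
    define k where "k = n div 2"
    have k: "n = 2 * k \<or> n = 2 * k + 1" "k < n" using False by (auto simp: k_def)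
    have "(\<Sum>i\<le>n. ruler i) \<le> (\<Sum>i\<le>2 * k + 1. ruler i)"
      using k by (intro sum_mono2) auto
    also have "\<dots> \<le> k + k" unfolding double using less[OF k(2)] by simp
    finally show ?thesis using k by auto
  qed
qed

text \<open>Level m is attained with density 2^(-m-1), so the gaps between blocks, although proportional to
  the levels and hence unbounded, are bounded on average. This makes the set of positions of the
  blocks of a given level have positive lower density.\<close>

definition block_level :: "nat \<Rightarrow> nat" where
  "block_level j = ruler (Suc j)"

definition block_pos :: "nat \<Rightarrow> nat" where
  "block_pos j = 2 * block_level j + 4 * (\<Sum>i<j. block_level i)"

lemma block_pos_ge: "2 * block_level j \<le> block_pos j"
  by (simp add: block_pos_def)

lemma block_pos_separated:
  assumes "i < j"
  shows "block_pos i + 2 * block_level i + 2 * block_level j \<le> block_pos j"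
proof -
  have "(\<Sum>k<i. block_level k) + block_level i = (\<Sum>k<Suc i. block_level k)" by simp
  also have "\<dots> \<le> (\<Sum>k<j. block_level k)" using assms by (intro sum_mono2) auto
  finally show ?thesis by (simp add: block_pos_def)
qed

lemma block_pos_dist:
  assumes "i \<noteq> j"
  shows "2 * int (block_level i) + 2 * int (block_level j) \<le> \<bar>int (block_pos i) - int (block_pos j)\<bar>"
  using block_pos_separated[of i j] block_pos_separated[of j i] assms
  by (cases "i < j") auto

lemma block_pos_le: "block_pos j \<le> 4 * Suc j"
proof -
  have "block_pos j \<le> 4 * (\<Sum>i<Suc j. ruler (Suc i))"
    by (simp add: block_pos_def block_level_def)
  also have "\<dots> \<le> 4 * (\<Sum>i\<le>Suc j. ruler i)"
    unfolding lessThan_Suc_atMost by (simp add: sum.atMost_Suc_shift del: sum.atMost_Suc)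
  also have "\<dots> \<le> 4 * Suc j"
    by (intro mult_left_mono sum_ruler_le) simp
  finally show ?thesis .
qed

lemma lower_density_pos:
  assumes "inj q" "\<And>t. q t \<in> A" "\<And>t. q t \<le> c * Suc t" "c > 0"
  shows "lower_density A > 0"
proof -
  have "ereal (1 / (4 * real c)) \<le> lower_density A"
    unfolding lower_density_def
  proof (rule Liminf_bounded, rule eventually_sequentiallyI)
    fix N assume N: "2 * c \<le> N"
    have "q ` {..<N div c} \<subseteq> A \<inter> {..N}"
    proof safe
      fix t assume "t < N div c"
      then have "c * Suc t \<le> c * (N div c)" by (intro mult_left_mono) auto
      also have "\<dots> \<le> N" by simp
      finally show "q t \<le> N" using assms(3)[of t] by simp
    qed (use assms in auto)
    then have "card (q ` {..<N div c}) \<le> card (A \<inter> {..N})" by (intro card_mono) auto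
    then have "N div c \<le> card (A \<inter> {..N})"
      using assms(1) by (simp add: card_image inj_on_subset[OF assms(1)])
    moreover have "real N / real c - 1 \<le> real (N div c)"
    proof -
      have "N < c + c * (N div c)" using assms(4) by (rule dividend_less_times_div)
      then have "real N < real (c + c * (N div c))" by (simp only: of_nat_less_iff)
      then show ?thesis using assms(4) by (simp add: field_simps)
    qed
    ultimately have "real N / real c - 1 \<le> real (card (A \<inter> {..N}))" by linarith
    moreover have "real (N + 1) / (4 * real c) \<le> real N / real c - 1"
    proof -
      have "real (N + 1) \<le> 4 * real N - 4 * real c" using N assms(4) by linarith
      then have "real (N + 1) / (4 * real c) \<le> (4 * real N - 4 * real c) / (4 * real c)"
        by (intro divide_right_mono) auto
      also have "\<dots> = real N / real c - 1" using assms(4) by (simp add: diff_divide_distrib)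
      finally show ?thesis .
    qed
    ultimately have "real (N + 1) / (4 * real c) \<le> real (card (A \<inter> {..N}))" by linarith
    then show "ereal (1 / (4 * real c)) \<le> ereal (real (card (A \<inter> {..N})) / real (N + 1))"
      using assms(4) by (simp add: field_simps)
  qed
  moreover have "0 < ereal (1 / (4 * real c))" using assms(4) by simp
  ultimately show ?thesis by (rule less_le_trans[rotated])
qed

lemma lower_density_block_level_pos:
  assumes "m > 0" "\<And>j. block_level j = m \<Longrightarrow> block_pos j \<in> A"
  shows "lower_density A > 0"
proof (rule lower_density_pos)
  define s where "s t = 2 ^ m * (2 * t + 1) - (1::nat)" for t
  have s: "Suc (s t) = 2 ^ m * (2 * t + 1)" for t by (simp add: s_def)
  have level: "block_level (s t) = m" for t
    unfolding block_level_def s by (rule ruler_power_mult)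
  show "inj (\<lambda>t. block_pos (s t))"
  proof (rule injI)
    fix t u assume "block_pos (s t) = block_pos (s u)"
    then have "s t = s u" using block_pos_dist[of "s t" "s u"] level assms(1) by force
    then have "2 ^ m * (2 * t + 1) = 2 ^ m * (2 * u + (1::nat))" by (metis s)
    then show "t = u" by simp
  qed
  show "block_pos (s t) \<in> A" for t using assms(2) level by blast
  show "block_pos (s t) \<le> 8 * 2 ^ m * Suc t" for t
    using block_pos_le[of "s t"] unfolding s by (simp add: algebra_simps)
qed simp

section \<open>Periodic points and frequently hypercyclic vectors\<close>

definition of_assoc_list :: "(int \<times> 'a::zero) list \<Rightarrow> int \<Rightarrow> 'a" where
  "of_assoc_list xs i = (case map_of xs i of None \<Rightarrow> 0 | Some v \<Rightarrow> v)"

lemma of_assoc_list_bounded: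
  fixes xs :: "(int \<times> 'a::real_normed_vector) list"
  obtains l :: nat where "\<And>i. norm (of_assoc_list xs i) \<le> real l"
    "\<And>i. int l < \<bar>i\<bar> \<Longrightarrow> of_assoc_list xs i = 0"
proof -
  define B where "B = (\<Sum>q\<leftarrow>xs. nat \<lceil>norm (snd q)\<rceil> + nat \<bar>fst q\<bar>)"
  have B: "nat \<lceil>norm v\<rceil> + nat \<bar>i\<bar> \<le> B" if "(i, v) \<in> set xs" for i v
    unfolding B_def using member_le_sum_list[of "nat \<lceil>norm v\<rceil> + nat \<bar>i\<bar>"
      "map (\<lambda>q. nat \<lceil>norm (snd q)\<rceil> + nat \<bar>fst q\<bar>) xs"] that by force
  show ?thesis
  proof (rule that[of B])
    fix i
    show "norm (of_assoc_list xs i) \<le> real B"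
    proof (cases "map_of xs i")
      case (Some v)
      then have "nat \<lceil>norm v\<rceil> + nat \<bar>i\<bar> \<le> B" by (intro B map_of_SomeD)
      then have "norm v \<le> real B" using real_nat_ceiling_ge[of "norm v"] by linarith
      then show ?thesis using Some by (simp add: of_assoc_list_def)
    qed (simp add: of_assoc_list_def)
    show "of_assoc_list xs i = 0" if "int B < \<bar>i\<bar>"
    proof (cases "map_of xs i")
      case (Some v)
      then have "nat \<lceil>norm v\<rceil> + nat \<bar>i\<bar> \<le> B" by (intro B map_of_SomeD)
      then show ?thesis using that by linarith
    qed (simp add: of_assoc_list_def)
  qed
qed

lemma finite_sequences_dense:
  fixes e z :: "int \<Rightarrow> 'a::real_normed_field"
  assumes p: "p \<ge> 1" and D: "\<And>b u. u > 0 \<Longrightarrow> \<exists>d\<in>D. norm (d - b) < u"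
    and e: "\<And>n. n \<in> I \<Longrightarrow> e n \<noteq> 0" "\<And>n. n \<notin> I \<Longrightarrow> e n = 0"
    and z: "z \<in> lp_space I p" and c: "c > 0"
  obtains xs where "xs \<in> lists (UNIV \<times> D)"
    "\<And>F. finite F \<Longrightarrow> (\<Sum>i\<in>F. norm (e i * of_assoc_list xs i - z i) powr p) \<le> c"
proof -
  obtain G where G: "finite G"
    "\<And>F. finite F \<Longrightarrow> F \<inter> G = {} \<Longrightarrow> (\<Sum>i\<in>F. norm (z i) powr p) \<le> c / 2"
    using summable_tail_finite[of "\<lambda>i. norm (z i) powr p" "c / 2"] z c by (auto simp: lp_space_def)
  define k where "k = c / 2 / real (Suc (card G))"
  have k: "k > 0" using c by (simp add: k_def)
  have "\<exists>d\<in>D. norm (e i * d - z i) powr p \<le> k" for i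
  proof (cases "i \<in> I")
    case True
    have "k powr (1 / p) / norm (e i) > 0" using k e True by simp
    then obtain d where d: "d \<in> D" "norm (d - z i / e i) < k powr (1 / p) / norm (e i)"
      using D by blast
    have "e i * d - z i = e i * (d - z i / e i)" using e True by (simp add: algebra_simps)
    then have "norm (e i * d - z i) = norm (d - z i / e i) * norm (e i)"
      by (simp only: norm_mult mult.commute)
    also have "\<dots> < k powr (1 / p)"
      using d(2) e(1)[OF True] by (metis pos_less_divide_eq zero_less_norm_iff)
    finally have "norm (e i * d - z i) \<le> k powr (1 / p)" by simp
    then have "norm (e i * d - z i) powr p \<le> (k powr (1 / p)) powr p"
      using p by (intro powr_mono2) auto
    also have "\<dots> = k" using p k by (simp add: powr_powr)
    finally show ?thesis using d by blast
  next
    case False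
    then have "e i = 0" "z i = 0" using e z by (auto simp: lp_space_def)
    then show ?thesis using D[of 1 0] k by auto
  qed
  then obtain f where f: "\<And>i. f i \<in> D" "\<And>i. norm (e i * f i - z i) powr p \<le> k" by metis
  define xs where "xs = map (\<lambda>i. (i, f i)) (sorted_list_of_set G)"
  have val: "of_assoc_list xs i = (if i \<in> G then f i else 0)" for i
    using G(1) by (simp add: of_assoc_list_def xs_def map_of_map_restrict restrict_map_def)
  show ?thesis
  proof (rule that[of xs])
    show "xs \<in> lists (UNIV \<times> D)" using f by (auto simp: xs_def)
    fix F :: "int set" assume F: "finite F"
    have "(\<Sum>i\<in>F. norm (e i * of_assoc_list xs i - z i) powr p)
       = (\<Sum>i\<in>F \<inter> G. norm (e i * of_assoc_list xs i - z i) powr p)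
         + (\<Sum>i\<in>F - G. norm (e i * of_assoc_list xs i - z i) powr p)"
      using F by (rule sum.Int_Diff)
    also have "(\<Sum>i\<in>F - G. norm (e i * of_assoc_list xs i - z i) powr p) = (\<Sum>i\<in>F - G. norm (z i) powr p)"
      by (intro sum.cong) (auto simp: val)
    also have "\<dots> \<le> c / 2" using F by (intro G(2)) auto
    also have "(\<Sum>i\<in>F \<inter> G. norm (e i * of_assoc_list xs i - z i) powr p) \<le> (\<Sum>i\<in>F \<inter> G. k)"
      by (intro sum_mono) (auto simp: val f)
    also have "\<dots> = real (card (F \<inter> G)) * k" by simp
    also have "\<dots> \<le> real (Suc (card G)) * k"
      using G(1) k card_mono[of G "F \<inter> G"] by (intro mult_right_mono) auto
    also have "\<dots> = c / 2" by (simp add: k_def del: of_nat_Suc)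
    finally show "(\<Sum>i\<in>F. norm (e i * of_assoc_list xs i - z i) powr p) \<le> c" by simp
  qed
qed

lemma bounded_multiple_in_lp:
  fixes e \<xi> :: "int \<Rightarrow> 'a::real_normed_field"
  assumes p: "p \<ge> 1" and e: "\<And>n. n \<notin> I \<Longrightarrow> e n = 0"
    and sum: "(\<lambda>i. norm (e i) powr p * g i powr p) summable_on UNIV"
    and le: "\<And>i. norm (\<xi> i) \<le> g i"
  shows "(\<lambda>i. e i * \<xi> i) \<in> lp_space I p"
proof -
  have "(\<lambda>i. norm (e i * \<xi> i) powr p) summable_on UNIV"
    using sum
  proof (rule summable_on_comparison_test)
    fix i
    have "norm (\<xi> i) powr p \<le> g i powr p" using p le by (intro powr_mono2) auto
    then show "norm (e i * \<xi> i) powr p \<le> norm (e i) powr p * g i powr p"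
      by (simp add: norm_mult powr_mult mult_left_mono)
  qed auto
  then show ?thesis using e by (simp add: lp_space_def)
qed

lemma periodic_points_dense:
  fixes w e :: "int \<Rightarrow> 'a::real_normed_field"
  assumes p: "1 \<le> p"
    and e: "\<And>n. n \<in> I \<Longrightarrow> e n \<noteq> 0" "\<And>n. n \<notin> I \<Longrightarrow> e n = 0"
       "\<And>n. n \<in> I \<Longrightarrow> w (n + 1) * e (n + 1) = e n"
    and sum: "(\<lambda>i. norm (e i) powr p) summable_on UNIV"
  shows "dense_in_sp (lp_space I p) (lp_dist p) (periodic_points (lp_space I p) (bw_shift I w))"
  unfolding dense_in_sp_def
proof (intro ballI allI impI)
  fix z :: "int \<Rightarrow> 'a" and r :: real assume z: "z \<in> lp_space I p" and r: "r > 0"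
  define c where "c = r powr p / (2 powr p * 4)"
  have c: "c > 0" using r by (simp add: c_def)
  have dense: "\<exists>d\<in>UNIV. norm (d - b) < u" if "u > 0" for b :: 'a and u
    using that by (intro bexI[of _ b]) auto
  obtain xs where xs: "\<And>F. finite F \<Longrightarrow> (\<Sum>i\<in>F. norm (e i * of_assoc_list xs i - z i) powr p) \<le> c"
    using finite_sequences_dense[where e = e and I = I and D = UNIV, OF p dense e(1,2) z c] by auto
  define \<zeta> where "\<zeta> = of_assoc_list xs"
  obtain l :: nat where l: "\<And>i. norm (\<zeta> i) \<le> real l" "\<And>i. int l < \<bar>i\<bar> \<Longrightarrow> \<zeta> i = 0"
    using of_assoc_list_bounded[of xs] unfolding \<zeta>_def by blast
  have sum_l: "(\<lambda>i. norm (e i) powr p * t powr p) summable_on UNIV" for t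
    using sum by (rule summable_on_cmult_left)
  obtain R where R: "\<And>F. finite F \<Longrightarrow> (\<And>i. i \<in> F \<Longrightarrow> R \<le> nat \<bar>i\<bar>) \<Longrightarrow>
      (\<Sum>i\<in>F. norm (e i) powr p * (2 * real l) powr p) \<le> c"
    using summable_tail_radius[OF sum_l _ c, of "2 * real l"] by auto
  define P where "P = int R + 2 * int l + 1"
  have P: "P > 0" by (simp add: P_def)
  define \<xi> where "\<xi> i = \<zeta> ((i + int l) mod P - int l)" for i
  have \<xi>_le: "norm (\<xi> i) \<le> real l" for i unfolding \<xi>_def by (rule l)
  have \<xi>_eq: "\<xi> i = \<zeta> i" if "\<bar>i\<bar> < int R" for i
  proof (cases "i \<ge> - int l")
    case True
    then have "(i + int l) mod P = i + int l" using that by (intro mod_pos_pos_trivial) (auto simp: P_def)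
    then show ?thesis by (simp add: \<xi>_def)
  next
    case False
    have "(i + int l) mod P = (i + int l + P) mod P" by simp
    also have "\<dots> = i + int l + P" using that False by (intro mod_pos_pos_trivial) (auto simp: P_def)
    finally have "\<xi> i = \<zeta> (i + P)" by (simp add: \<xi>_def)
    then show ?thesis using l(2)[of "i + P"] l(2)[of i] that False by (simp add: P_def)
  qed
  let ?x = "\<lambda>i. e i * \<xi> i"
  have "?x \<in> lp_space I p"
    using bounded_multiple_in_lp[where e = e and I = I and \<xi> = \<xi> and g = "\<lambda>_. real l", OF p e(2) sum_l \<xi>_le] by blast
  moreover have "(bw_shift I w ^^ nat P) ?x = ?x"
  proof -
    have "(bw_shift I w ^^ nat P) ?x = (\<lambda>i. e i * \<xi> (i + int (nat P)))"
      by (rule bw_shift_funpow) (use e in auto)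
    moreover have "\<xi> (i + P) = \<xi> i" for i
    proof -
      have "(i + P + int l) mod P = (i + int l) mod P"
        by (metis add.assoc add.commute mod_add_self2)
      then show ?thesis by (simp add: \<xi>_def)
    qed
    ultimately show ?thesis using P by simp
  qed
  ultimately have "?x \<in> periodic_points (lp_space I p) (bw_shift I w)"
    using P by (auto simp: periodic_points_def intro!: exI[of _ "nat P"])
  moreover have "lp_dist p ?x z < r"
  proof (rule lp_dist_lessI[OF p r, where c = "2 powr p * (c + c)"])
    show "2 powr p * (c + c) < r powr p" using r by (simp add: c_def)
    fix F :: "int set" assume F: "finite F"
    show "(\<Sum>i\<in>F. norm (e i * \<xi> i - z i) powr p) \<le> 2 powr p * (c + c)"
    proof (rule sum_norm_diff_powr_le[where t = "\<lambda>i. e i * \<zeta> i"])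
      show "(\<Sum>i\<in>F. norm (z i - e i * \<zeta> i) powr p) \<le> c"
        using xs[OF F] by (simp add: \<zeta>_def norm_minus_commute)
      have "(\<Sum>i\<in>F. norm (e i * \<xi> i - e i * \<zeta> i) powr p)
         = (\<Sum>i\<in>{i\<in>F. R \<le> nat \<bar>i\<bar>}. norm (e i * \<xi> i - e i * \<zeta> i) powr p)"
        using F by (intro sum.mono_neutral_right) (auto intro!: \<xi>_eq)
      also have "\<dots> \<le> (\<Sum>i\<in>{i\<in>F. R \<le> nat \<bar>i\<bar>}. norm (e i) powr p * (2 * real l) powr p)"
      proof (rule sum_mono)
        fix i
        have "norm (\<xi> i - \<zeta> i) \<le> 2 * real l"
          using norm_triangle_ineq4[of "\<xi> i" "\<zeta> i"] \<xi>_le[of i] l(1)[of i] by linarith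
        then have "norm (\<xi> i - \<zeta> i) powr p \<le> (2 * real l) powr p" using p by (intro powr_mono2) auto
        then show "norm (e i * \<xi> i - e i * \<zeta> i) powr p \<le> norm (e i) powr p * (2 * real l) powr p"
          unfolding right_diff_distrib[symmetric] by (simp only: norm_mult powr_mult norm_ge_zero mult_left_mono powr_ge_zero)
      qed
      also have "\<dots> \<le> c" using F by (intro R) auto
      finally show "(\<Sum>i\<in>F. norm (e i * \<xi> i - e i * \<zeta> i) powr p) \<le> c" .
    qed (use p in auto)
  qed
  ultimately show "\<exists>a\<in>periodic_points (lp_space I p) (bw_shift I w). lp_dist p a z < r" by blast
qed

lemma dense_block_sequence:
  fixes e :: "int \<Rightarrow> 'a::real_normed_field" and h :: "nat \<Rightarrow> nat"
  assumes p: "1 \<le> p" and h: "mono h" "\<And>l. \<exists>m. l \<le> h m"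
    and e: "\<And>n. n \<in> I \<Longrightarrow> e n \<noteq> 0" "\<And>n. n \<notin> I \<Longrightarrow> e n = 0"
  obtains Z :: "nat \<Rightarrow> int \<Rightarrow> 'a"
  where "\<And>m i. norm (Z m i) \<le> real (h m)" "\<And>m i. int (h m) < \<bar>i\<bar> \<Longrightarrow> Z m i = 0"
    "\<And>z c m0. z \<in> lp_space I p \<Longrightarrow> c > 0 \<Longrightarrow>
       \<exists>m\<ge>m0. \<forall>F. finite F \<longrightarrow> (\<Sum>i\<in>F. norm (e i * Z m i - z i) powr p) \<le> c"
proof -
  obtain D :: "'a set" where D: "countable D" "\<And>b u. u > 0 \<Longrightarrow> \<exists>d\<in>D. norm (d - b) < u"
    using real_normed_field_separable by blast
  define Q where "Q = lists (UNIV \<times> D :: (int \<times> 'a) set)"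
  have Q: "countable Q" "Q \<noteq> {}" unfolding Q_def using D by auto
  define \<zeta> where "\<zeta> m = of_assoc_list (from_nat_into Q (fst (prod_decode m)))" for m
  define fits where "fits m \<longleftrightarrow> (\<forall>i. norm (\<zeta> m i) \<le> real (h m)) \<and> (\<forall>i. int (h m) < \<bar>i\<bar> \<longrightarrow> \<zeta> m i = 0)"
    for m
  define Z where "Z m = (if fits m then \<zeta> m else (\<lambda>_. 0))" for m
  show ?thesis
  proof (rule that[of Z])
    show "norm (Z m i) \<le> real (h m)" for m i by (simp add: Z_def fits_def)
    show "Z m i = 0" if "int (h m) < \<bar>i\<bar>" for m i using that by (simp add: Z_def fits_def)
    fix z :: "int \<Rightarrow> 'a" and c :: real and m0 :: nat assume z: "z \<in> lp_space I p" and c: "c > 0"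
    obtain xs where xs: "xs \<in> Q"
      "\<And>F. finite F \<Longrightarrow> (\<Sum>i\<in>F. norm (e i * of_assoc_list xs i - z i) powr p) \<le> c"
      using finite_sequences_dense[where e = e and I = I and D = D, OF p D(2) e z c] unfolding Q_def by blast
    obtain k where k: "from_nat_into Q k = xs" using from_nat_into_surj[OF Q(1) xs(1)] by blast
    obtain l :: nat where l: "\<And>i. norm (of_assoc_list xs i) \<le> real l"
      "\<And>i. int l < \<bar>i\<bar> \<Longrightarrow> of_assoc_list xs i = 0"
      using of_assoc_list_bounded[of xs] by blast
    obtain m1 where m1: "l \<le> h m1" using h(2) by blast
    define m where "m = prod_encode (k, max m0 m1)"
    have m: "max m0 m1 \<le> m" unfolding m_def by (rule le_prod_encode_2)
    have "h m1 \<le> h m" using h(1) m by (simp add: monoD)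
    with m1 have lh: "l \<le> h m" by simp
    have \<zeta>: "\<zeta> m = of_assoc_list xs" by (simp add: \<zeta>_def m_def k)
    have "fits m"
      unfolding fits_def \<zeta> using l lh by (auto intro: order_trans[of _ "real l"])
    then have "Z m = of_assoc_list xs" by (simp add: Z_def \<zeta>)
    with xs(2) m show "\<exists>m\<ge>m0. \<forall>F. finite F \<longrightarrow> (\<Sum>i\<in>F. norm (e i * Z m i - z i) powr p) \<le> c"
      by (intro exI[of _ m]) auto
  qed
qed

lemma block_concatenation:
  fixes Z :: "nat \<Rightarrow> int \<Rightarrow> 'a::real_normed_vector"
  assumes h: "mono h" "\<And>m. h m \<le> m"
    and Z: "\<And>m i. norm (Z m i) \<le> real (h m)" "\<And>m i. int (h m) < \<bar>i\<bar> \<Longrightarrow> Z m i = 0"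
  obtains \<xi> where "\<And>i. norm (\<xi> i) \<le> real (h (nat \<bar>i\<bar>))"
    "\<And>j i. norm (\<xi> (i + int (block_pos j)) - Z (block_level j) i) \<le>
       (if block_level j \<le> nat \<bar>i\<bar> then real (h (nat \<bar>i\<bar>)) else 0)"
proof -
  define near where "near i j \<longleftrightarrow>
      0 < h (block_level j) \<and> \<bar>i - int (block_pos j)\<bar> \<le> int (h (block_level j))" for i j
  define \<xi> where "\<xi> i = (if \<exists>j. near i j
      then Z (block_level (SOME j. near i j)) (i - int (block_pos (SOME j. near i j))) else 0)" for i
  have unique: "j = j'" if "near i j" "near i j'" for i j j'
  proof (rule ccontr)
    assume "j \<noteq> j'"
    then show False
      using that block_pos_dist[of j j'] h(2)[of "block_level j"] h(2)[of "block_level j'"]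
      unfolding near_def by linarith
  qed
  have \<xi>_near: "\<xi> i = Z (block_level j) (i - int (block_pos j))" if "near i j" for i j
    using that unique[OF someI[of "near i" j]] by (auto simp: \<xi>_def)
  have \<xi>_far: "\<xi> i = 0" if "\<And>j. \<not> near i j" for i using that by (simp add: \<xi>_def)
  have h_le: "h m \<le> h n" if "m \<le> n" for m n using h(1) that by (rule monoD)
  show ?thesis
  proof (rule that[of \<xi>])
    fix i
    show "norm (\<xi> i) \<le> real (h (nat \<bar>i\<bar>))"
    proof (cases "\<exists>j. near i j")
      case True
      then obtain j where j: "near i j" by blast
      have "block_level j \<le> nat \<bar>i\<bar>"
        using j h(2)[of "block_level j"] block_pos_ge[of j] unfolding near_def by linarith
      from h_le[OF this] show ?thesis
        using \<xi>_near[OF j] Z(1)[of "block_level j" "i - int (block_pos j)"] by simp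
    qed (use \<xi>_far in auto)
  next
    fix j i
    let ?m = "block_level j" and ?i = "i + int (block_pos j)"
    show "norm (\<xi> ?i - Z ?m i) \<le> (if ?m \<le> nat \<bar>i\<bar> then real (h (nat \<bar>i\<bar>)) else 0)"
    proof (cases "near ?i j")
      case True
      then show ?thesis using \<xi>_near[OF True] by simp
    next
      case False
      have Z0: "Z ?m i = 0"
      proof (cases "h ?m = 0")
        case True
        then show ?thesis using Z(1)[of ?m i] by simp
      next
        case nz: False
        with False show ?thesis by (intro Z(2)) (simp add: near_def)
      qed
      show ?thesis
      proof (cases "\<exists>j'. near ?i j'")
        case True
        then obtain j' where j': "near ?i j'" by blast
        with False have "j' \<noteq> j" by blast
        from block_pos_dist[OF this]
        have "2 * int (block_level j') + 2 * int ?m \<le> \<bar>i\<bar> + int (h (block_level j'))"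
          using j' unfolding near_def by linarith
        then have i: "?m \<le> nat \<bar>i\<bar>" "block_level j' \<le> nat \<bar>i\<bar>"
          using h(2)[of "block_level j'"] by linarith+
        have "norm (\<xi> ?i) \<le> real (h (block_level j'))"
          unfolding \<xi>_near[OF j'] by (rule Z)
        then show ?thesis using i h_le[OF i(2)] Z0 by simp
      qed (use \<xi>_far[of ?i] Z0 in auto)
    qed
  qed
qed

lemma orbit_with_positive_lower_density:
  fixes w e :: "int \<Rightarrow> 'a::real_normed_field"
  assumes p: "1 \<le> p"
    and e: "\<And>n. n \<in> I \<Longrightarrow> e n \<noteq> 0" "\<And>n. n \<notin> I \<Longrightarrow> e n = 0"
       "\<And>n. n \<in> I \<Longrightarrow> w (n + 1) * e (n + 1) = e n"
    and sum: "(\<lambda>i. norm (e i) powr p) summable_on UNIV"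
  obtains x where "x \<in> lp_space I p"
    "\<And>z r. z \<in> lp_space I p \<Longrightarrow> r > 0 \<Longrightarrow>
       lower_density {n. lp_dist p ((bw_shift I w ^^ n) x) z < r} > 0"
proof -
  obtain h :: "nat \<Rightarrow> nat" where h: "mono h" "\<And>m. h m \<le> m" "\<And>l. \<exists>m. l \<le> h m"
    and sum_h: "(\<lambda>i. norm (e i) powr p * real (h (nat \<bar>i\<bar>)) powr p) summable_on UNIV"
    using slow_weight_exists[OF sum, of p] by auto
  obtain Z :: "nat \<Rightarrow> int \<Rightarrow> 'a" where
    Z: "\<And>m i. norm (Z m i) \<le> real (h m)" "\<And>m i. int (h m) < \<bar>i\<bar> \<Longrightarrow> Z m i = 0"
    and Z_dense: "\<And>z c m0. z \<in> lp_space I p \<Longrightarrow> c > 0 \<Longrightarrow>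
       \<exists>m\<ge>m0. \<forall>F. finite F \<longrightarrow> (\<Sum>i\<in>F. norm (e i * Z m i - z i) powr p) \<le> c"
    using dense_block_sequence[where e = e and I = I, OF p h(1,3) e(1,2)] by blast
  obtain \<xi> where \<xi>: "\<And>i. norm (\<xi> i) \<le> real (h (nat \<bar>i\<bar>))"
    "\<And>j i. norm (\<xi> (i + int (block_pos j)) - Z (block_level j) i) \<le>
       (if block_level j \<le> nat \<bar>i\<bar> then real (h (nat \<bar>i\<bar>)) else 0)"
    using block_concatenation[where Z = Z, OF h(1,2) Z] by blast
  let ?x = "\<lambda>i. e i * \<xi> i"
  have orbit: "(bw_shift I w ^^ n) ?x = (\<lambda>i. e i * \<xi> (i + int n))" for n
    by (rule bw_shift_funpow) (use e in auto)
  have x: "?x \<in> lp_space I p" by (rule bounded_multiple_in_lp[where e = e and \<xi> = \<xi>, OF p e(2) sum_h \<xi>(1)])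
  show ?thesis
  proof (rule that[OF x])
    fix z :: "int \<Rightarrow> 'a" and r :: real assume z: "z \<in> lp_space I p" and r: "r > 0"
    define c where "c = r powr p / (2 powr p * 4)"
    have c: "c > 0" using r by (simp add: c_def)
    obtain R where R: "\<And>F. finite F \<Longrightarrow> (\<And>i. i \<in> F \<Longrightarrow> R \<le> nat \<bar>i\<bar>) \<Longrightarrow>
        (\<Sum>i\<in>F. norm (e i) powr p * real (h (nat \<bar>i\<bar>)) powr p) \<le> c"
      using summable_tail_radius[OF sum_h _ c] by auto
    obtain m where m: "Suc R \<le> m"
      and Zm: "\<And>F. finite F \<Longrightarrow> (\<Sum>i\<in>F. norm (e i * Z m i - z i) powr p) \<le> c"
      using Z_dense[OF z c] by blast
    show "lower_density {n. lp_dist p ((bw_shift I w ^^ n) ?x) z < r} > 0"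
    proof (rule lower_density_block_level_pos)
      show "m > 0" using m by simp
      fix j assume j: "block_level j = m"
      define n where "n = block_pos j"
      have "lp_dist p (\<lambda>i. e i * \<xi> (i + int n)) z < r"
      proof (rule lp_dist_lessI[OF p r, where c = "2 powr p * (c + c)"])
        show "2 powr p * (c + c) < r powr p" using r by (simp add: c_def)
        fix F :: "int set" assume F: "finite F"
        show "(\<Sum>i\<in>F. norm (e i * \<xi> (i + int n) - z i) powr p) \<le> 2 powr p * (c + c)"
        proof (rule sum_norm_diff_powr_le[where t = "\<lambda>i. e i * Z m i"])
          show "(\<Sum>i\<in>F. norm (z i - e i * Z m i) powr p) \<le> c"
            using Zm[OF F] by (simp add: norm_minus_commute)
          let ?G = "{i\<in>F. R \<le> nat \<bar>i\<bar>}"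
          have le: "norm (\<xi> (i + int n) - Z m i) \<le> (if m \<le> nat \<bar>i\<bar> then real (h (nat \<bar>i\<bar>)) else 0)"
            for i using \<xi>(2)[of i j] unfolding j n_def .
          have zero: "\<xi> (i + int n) = Z m i" if "\<not> R \<le> nat \<bar>i\<bar>" for i
            using le[of i] that m by (simp split: if_splits)
          have "(\<Sum>i\<in>F. norm (e i * \<xi> (i + int n) - e i * Z m i) powr p)
             = (\<Sum>i\<in>?G. norm (e i * \<xi> (i + int n) - e i * Z m i) powr p)"
            using F by (intro sum.mono_neutral_right) (auto simp: zero)
          also have "\<dots> \<le> (\<Sum>i\<in>?G. norm (e i) powr p * real (h (nat \<bar>i\<bar>)) powr p)"
          proof (rule sum_mono)
            fix i
            have "norm (\<xi> (i + int n) - Z m i) \<le> real (h (nat \<bar>i\<bar>))"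
              using le[of i] by (auto split: if_splits)
            then have "norm (\<xi> (i + int n) - Z m i) powr p \<le> real (h (nat \<bar>i\<bar>)) powr p"
              using p by (intro powr_mono2) auto
            then show "norm (e i * \<xi> (i + int n) - e i * Z m i) powr p
                \<le> norm (e i) powr p * real (h (nat \<bar>i\<bar>)) powr p"
              unfolding right_diff_distrib[symmetric]
              by (simp only: norm_mult powr_mult norm_ge_zero mult_left_mono powr_ge_zero)
          qed
          also have "\<dots> \<le> c" using F by (intro R) auto
          finally show "(\<Sum>i\<in>F. norm (e i * \<xi> (i + int n) - e i * Z m i) powr p) \<le> c" .
        qed (use p in auto)
      qed
      then show "block_pos j \<in> {n. lp_dist p ((bw_shift I w ^^ n) ?x) z < r}"
        by (simp add: orbit n_def)
    qed
  qed
qed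

theorem theorem3p4:
  fixes p :: real and I :: "int set" and w :: "int \<Rightarrow> 'a::{real_normed_field, banach}"
    and x y :: "int \<Rightarrow> 'a"
  assumes p: "1 \<le> p"
    and I: "I = {0..} \<or> I = UNIV"
    and w_nz: "\<And>n. n - 1 \<in> I \<Longrightarrow> w n \<noteq> 0"
    and maps: "\<And>z. z \<in> lp_space I p \<Longrightarrow> bw_shift I w z \<in> lp_space I p"
    and bounded: "\<exists>C. \<forall>z \<in> lp_space I p. lp_norm p (bw_shift I w z) \<le> C * lp_norm p z"
    and x: "x \<in> lp_space I p"
    and y: "y \<in> lp_space I p" "\<exists>n. y n \<noteq> 0"
    and ubd: "\<And>V. nbhd_in (lp_space I p) (lp_dist p) y V \<Longrightarrow>
               upper_banach_density {n. (bw_shift I w ^^ n) x \<in> V} > 0"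
  shows "chaotic (lp_space I p) (lp_dist p) (bw_shift I w) \<and>
         frequently_hypercyclic (lp_space I p) (lp_dist p) (bw_shift I w)"
proof -
  let ?X = "lp_space I p :: (int \<Rightarrow> 'a) set" and ?T = "bw_shift I w"
  obtain e where e: "\<And>n. n \<in> I \<Longrightarrow> e n \<noteq> 0" "\<And>n. n \<notin> I \<Longrightarrow> e n = 0"
    "\<And>n. n \<in> I \<Longrightarrow> w (n + 1) * e (n + 1) = e n"
    using weighted_shift_fixed_vector[where w = w, OF I w_nz] by blast
  obtain k where k: "y k \<noteq> 0" using y by blast
  have sum: "(\<lambda>i. norm (e i) powr p) summable_on UNIV"
    by (rule fixed_vector_summable[where e = e and w = w, OF p I e bounded x y(1) k ubd])
  obtain v where v: "v \<in> ?X" and dens: "\<And>z r. z \<in> ?X \<Longrightarrow> r > 0 \<Longrightarrow>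
      lower_density {n. lp_dist p ((?T ^^ n) v) z < r} > 0"
    using orbit_with_positive_lower_density[where e = e and I = I and w = w, OF p e sum] by blast
  have orbit: "(?T ^^ n) v \<in> ?X" for n by (induction n) (simp_all add: v maps)
  have "hypercyclic ?X (lp_dist p) ?T"
    unfolding hypercyclic_def dense_in_sp_def
  proof (intro bexI[OF _ v] ballI allI impI)
    fix z r assume z: "z \<in> ?X" and r: "(r::real) > 0"
    have "{n. lp_dist p ((?T ^^ n) v) z < r} \<noteq> {}"
    proof
      assume "{n. lp_dist p ((?T ^^ n) v) z < r} = {}"
      with dens[OF z r] show False by (simp add: lower_density_def Liminf_const)
    qed
    then show "\<exists>a\<in>{(?T ^^ n) v |n. True}. lp_dist p a z < r" by blast
  qed
  moreover have "frequently_hypercyclic ?X (lp_dist p) ?T"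
    unfolding frequently_hypercyclic_def
  proof (intro bexI[OF _ v] allI impI)
    fix U assume U: "open_in_sp ?X (lp_dist p) U \<and> U \<noteq> {}"
    then obtain u r where u: "u \<in> U" "u \<in> ?X" and r: "r > 0" "open_ball_in ?X (lp_dist p) u r \<subseteq> U"
      unfolding open_in_sp_def nbhd_in_def by blast
    have sub: "{n. lp_dist p ((?T ^^ n) v) u < r} \<subseteq> {n. (?T ^^ n) v \<in> U}"
      using r(2) orbit by (auto simp: open_ball_in_def)
    have "lower_density {n. lp_dist p ((?T ^^ n) v) u < r} \<le> lower_density {n. (?T ^^ n) v \<in> U}"
      unfolding lower_density_def using sub
      by (intro Liminf_mono always_eventually allI) (auto intro!: divide_right_mono card_mono)
    with dens[OF u(2) r(1)] show "lower_density {n. (?T ^^ n) v \<in> U} > 0"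
      by (rule less_le_trans)
  qed
  moreover have "dense_in_sp ?X (lp_dist p) (periodic_points ?X ?T)"
    by (rule periodic_points_dense[where e = e, OF p e sum])
  ultimately show ?thesis by (simp add: chaotic_def)
qed

end
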